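(* Let $\mathcal X$ be a Polish space and let $G$ be a countable group of homeomorphisms of $\mathcal X$ which acts freely on a comeager subset of $\mathcal X$ and locally commutatively on all of $\mathcal X$, and which has a subgroup which is free on $m$ generators ($m\ge 1$). Suppose that a system of $m$ congruences is specified by pairs $(L_i,R_i)$, $1\le i\le m$, of subsets of $\{1,2,\dots,r\}$, and that this system is weak and consistent. Then there is a sequence of nonmeager sets $A_k\subseteq\mathcal X$ ($1\le k\le r$) with the property of Baire which is a solution to the system (with witnesses in $G$). Furthermore, if the system is nonredundant, and elements $f_i$ ($1\le i\le m$) of $G$ are free generators for a free subgroup of $G$, then there is a sequence of nonmeager sets $A_k\subseteq\mathcal X$ ($1\le k\le r$) with the property of Baire which is a solution to the system such that, for each $i\le m$, $f_i$ witnesses that $\bigcup_{k\in L_i}A_k$ is congruent to $\bigcup_{k\in R_i}A_k$, i.e. $f_i\bigl(\bigcup_{k\in L_i}A_k\bigr)=\bigcup_{k\in R_i}A_k$.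
   Context: Fix a positive integer $r$; for $S\subseteq\{1,\dots,r\}$ write $S^c=\{1,\dots,r\}\setminus S$. A congruence is a pair $(L,R)$ of subsets of $\{1,\dots,r\}$, written formally $\bigcup_{k\in L}A_k\cong\bigcup_{k\in R}A_k$; a system of congruences is a finite list of pairs $(L_i,R_i)$, $i\le m$. Deducibility of congruences: the congruences deducible from a system are those obtained from its members (read symmetrically, so $(L,R)$ also gives $(R,L)$) by taking complements ($(L,R)$ gives $(L^c,R^c)$) and transitivity ($(L,M)$ and $(M,R)$ give $(L,R)$). The system is weak if no congruence of the form $(L,L^c)$ is deducible from it. It is nonredundant if no congruence in the system is deducible from the other congruences in the system, and no $(L_i,R_i)$ has $L_i=R_i$. Deducibility of subcongruences: let $\preceq$ be the smallest transitive relation on subsets of $\{1,\dots,r\}$ such that $L\preceq R$ whenever $L\subseteq R$, and $L_i\preceq R_i$, $R_i\preceq L_i$, $L_i^c\preceq R_i^c$, $R_i^c\preceq L_i^c$ for all $i\le m$. The system is consistent if there are no $L,R$ with $R$ a proper subset of $L$ and $L\preceq R$. Let $G$ be a group of homeomorphisms of $\mathcal X$. $G$ acts freely on a comeager subset if there is a comeager ($G$-invariant) set on which no nonidentity element of $G$ has a fixed point. $G$ acts locally commutatively on $\mathcal X$ if any two elements of $G$ with a common fixed point in $\mathcal X$ commute. A solution to a system of congruences is a sequence of sets $A_k\subseteq\mathcal X$ ($k\le r$) which are pairwise disjoint and have union $\mathcal X$, such that for each $i\le m$ there is $\sigma_i\in G$ (the witness) with $\sigma_i(\bigcup_{k\in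 L_i}A_k)=\bigcup_{k\in R_i}A_k$. A set has the property of Baire if it differs from an open set by a meager set. *)

theory Defs
  imports "HOL-Analysis.Analysis" "HOL-Algebra.Generated_Groups"
begin

section \<open>Baire category\<close>

definition nowhere_dense :: "'a::topological_space set \<Rightarrow> bool" where
  "nowhere_dense S \<longleftrightarrow> interior (closure S) = {}"

definition meager :: "'a::topological_space set \<Rightarrow> bool" where
  "meager S \<longleftrightarrow> (\<exists>F :: nat \<Rightarrow> 'a set. (\<forall>n. nowhere_dense (F n)) \<and> S = (\<Union>n. F n))"

definition comeager :: "'a::topological_space set \<Rightarrow> bool" where
  "comeager S \<longleftrightarrow> meager (- S)"

definition baire_property :: "'a::topological_space set \<Rightarrow> bool" where
  "baire_property S \<longleftrightarrow> (\<exists>U. open U \<and> meager (sym_diff S U))"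


section \<open>Groups of homeomorphisms\<close>

text \<open>A group of homeomorphisms of a space is a subgroup \<open>G\<close> of the following group;
  the space is the whole type.\<close>

definition Homeo :: "('a::topological_space \<Rightarrow> 'a) monoid" where
  "Homeo = \<lparr>carrier = {f. \<exists>g. homeomorphism UNIV UNIV f g}, mult = (\<circ>), one = id\<rparr>"

lemma group_Homeo: "group (Homeo :: ('a::topological_space \<Rightarrow> 'a) monoid)"
proof (rule groupI)
  fix x y :: "'a \<Rightarrow> 'a"
  assume "x \<in> carrier Homeo" "y \<in> carrier Homeo"
  then show "x \<otimes>\<^bsub>Homeo\<^esub> y \<in> carrier Homeo"
    by (auto simp: Homeo_def intro: homeomorphism_compose)
next
  show "\<one>\<^bsub>Homeo\<^esub> \<in> carrier (Homeo :: ('a \<Rightarrow> 'a) monoid)"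
    by (auto simp: Homeo_def homeomorphism_def intro!: exI[of _ id])
next
  fix x :: "'a \<Rightarrow> 'a"
  assume "x \<in> carrier Homeo"
  then obtain y where y: "homeomorphism UNIV UNIV x y"
    by (auto simp: Homeo_def)
  then have "y \<circ> x = id" by (auto simp: homeomorphism_def)
  moreover have "homeomorphism UNIV UNIV y x" using y by (simp add: homeomorphism_symD)
  ultimately show "\<exists>y\<in>carrier Homeo. y \<otimes>\<^bsub>Homeo\<^esub> x = \<one>\<^bsub>Homeo\<^esub>"
    by (auto simp: Homeo_def)
qed (auto simp: Homeo_def comp_assoc)

definition acts_freely_on_comeager :: "('a::topological_space \<Rightarrow> 'a) set \<Rightarrow> bool" where
  "acts_freely_on_comeager G \<longleftrightarrow>
     (\<exists>D. comeager D \<and> (\<forall>g\<in>G. g ` D = D) \<and> (\<forall>g\<in>G. g \<noteq> id \<longrightarrow> (\<forall>x\<in>D. g x \<noteq> x)))"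

definition acts_locally_commutatively :: "('a \<Rightarrow> 'a) set \<Rightarrow> bool" where
  "acts_locally_commutatively G \<longleftrightarrow>
     (\<forall>g\<in>G. \<forall>h\<in>G. (\<exists>x. g x = x \<and> h x = x) \<longrightarrow> g \<circ> h = h \<circ> g)"


section \<open>Free groups\<close>

text \<open>A word is a list of letters; \<open>(i, True)\<close> stands for the generator with index \<open>i\<close>
  and \<open>(i, False)\<close> for its inverse.\<close>

definition letter_val :: "('b, 'c) monoid_scheme \<Rightarrow> ('i \<Rightarrow> 'b) \<Rightarrow> 'i \<times> bool \<Rightarrow> 'b" where
  "letter_val H f l = (if snd l then f (fst l) else inv\<^bsub>H\<^esub> f (fst l))"

definition word_val :: "('b, 'c) monoid_scheme \<Rightarrow> ('i \<Rightarrow> 'b) \<Rightarrow> ('i \<times> bool) list \<Rightarrow> 'b" where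
  "word_val H f w = foldr (\<lambda>l x. letter_val H f l \<otimes>\<^bsub>H\<^esub> x) w \<one>\<^bsub>H\<^esub>"

definition reduced_word :: "('i \<times> bool) list \<Rightarrow> bool" where
  "reduced_word w \<longleftrightarrow> successively (\<lambda>k l. \<not> (fst k = fst l \<and> snd k \<noteq> snd l)) w"

text \<open>\<open>H\<close> is a free group and the \<open>f i\<close>, \<open>i \<in> I\<close>, are free generators of it. Injectivity of
  \<open>f\<close> on \<open>I\<close> is implied: \<open>[(i, True), (j, False)]\<close> is reduced if \<open>i \<noteq> j\<close>.\<close>

definition free_generators :: "('b, 'c) monoid_scheme \<Rightarrow> 'i set \<Rightarrow> ('i \<Rightarrow> 'b) \<Rightarrow> bool" where
  "free_generators H I f \<longleftrightarrow>
     group H \<and> f ` I \<subseteq> carrier H \<and> generate H (f ` I) = carrier H \<and>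
     (\<forall>w. w \<noteq> [] \<and> reduced_word w \<and> fst ` set w \<subseteq> I \<longrightarrow> word_val H f w \<noteq> \<one>\<^bsub>H\<^esub>)"

definition free_on :: "('b, 'c) monoid_scheme \<Rightarrow> nat \<Rightarrow> bool" where
  "free_on H m \<longleftrightarrow> (\<exists>f. free_generators H {1..m} f)"


section \<open>Systems of congruences\<close>

text \<open>A system of \<open>m\<close> congruences is given by \<open>L i\<close>, \<open>R i\<close> for \<open>i \<in> {1..m}\<close>;
  \<open>congs L R I\<close> is the set of its members with index in \<open>I\<close>.\<close>

definition congs ::
  "(nat \<Rightarrow> nat set) \<Rightarrow> (nat \<Rightarrow> nat set) \<Rightarrow> nat set \<Rightarrow> (nat set \<times> nat set) set" where
  "congs L R I = (\<lambda>i. (L i, R i)) ` I"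

inductive deducible :: "nat \<Rightarrow> (nat set \<times> nat set) set \<Rightarrow> nat set \<Rightarrow> nat set \<Rightarrow> bool"
  for r :: nat and C :: "(nat set \<times> nat set) set" where
  member: "(A, B) \<in> C \<Longrightarrow> deducible r C A B"
| member_sym: "(A, B) \<in> C \<Longrightarrow> deducible r C B A"
| complement: "deducible r C A B \<Longrightarrow> deducible r C ({1..r} - A) ({1..r} - B)"
| transitive: "deducible r C A M \<Longrightarrow> deducible r C M B \<Longrightarrow> deducible r C A B"

inductive sub_deducible :: "nat \<Rightarrow> (nat set \<times> nat set) set \<Rightarrow> nat set \<Rightarrow> nat set \<Rightarrow> bool"
  for r :: nat and C :: "(nat set \<times> nat set) set" where
  subset: "A \<subseteq> B \<Longrightarrow> B \<subseteq> {1..r} \<Longrightarrow> sub_deducible r C A B"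
| left_right: "(A, B) \<in> C \<Longrightarrow> sub_deducible r C A B"
| right_left: "(A, B) \<in> C \<Longrightarrow> sub_deducible r C B A"
| compl_left_right: "(A, B) \<in> C \<Longrightarrow> sub_deducible r C ({1..r} - A) ({1..r} - B)"
| compl_right_left: "(A, B) \<in> C \<Longrightarrow> sub_deducible r C ({1..r} - B) ({1..r} - A)"
| transitive: "sub_deducible r C A M \<Longrightarrow> sub_deducible r C M B \<Longrightarrow> sub_deducible r C A B"

definition weak_system :: "nat \<Rightarrow> nat \<Rightarrow> (nat \<Rightarrow> nat set) \<Rightarrow> (nat \<Rightarrow> nat set) \<Rightarrow> bool" where
  "weak_system r m L R \<longleftrightarrow>
     \<not> (\<exists>A. A \<subseteq> {1..r} \<and> deducible r (congs L R {1..m}) A ({1..r} - A))"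

text \<open>\<open>The other congruences\<close> are those with a different index, so a system in which a
  congruence is repeated is redundant.\<close>

definition nonredundant_system :: "nat \<Rightarrow> nat \<Rightarrow> (nat \<Rightarrow> nat set) \<Rightarrow> (nat \<Rightarrow> nat set) \<Rightarrow> bool" where
  "nonredundant_system r m L R \<longleftrightarrow>
     (\<forall>i\<in>{1..m}. \<not> deducible r (congs L R ({1..m} - {i})) (L i) (R i) \<and> L i \<noteq> R i)"

definition consistent_system :: "nat \<Rightarrow> nat \<Rightarrow> (nat \<Rightarrow> nat set) \<Rightarrow> (nat \<Rightarrow> nat set) \<Rightarrow> bool" where
  "consistent_system r m L R \<longleftrightarrow>
     \<not> (\<exists>A B. A \<subseteq> {1..r} \<and> B \<subset> A \<and> sub_deducible r (congs L R {1..m}) A B)"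

definition witnesses ::
  "('a \<Rightarrow> 'a) \<Rightarrow> (nat \<Rightarrow> 'a set) \<Rightarrow> nat set \<Rightarrow> nat set \<Rightarrow> bool" where
  "witnesses \<sigma> A P Q \<longleftrightarrow> \<sigma> ` (\<Union>k\<in>P. A k) = (\<Union>k\<in>Q. A k)"

definition is_solution ::
  "('a \<Rightarrow> 'a) set \<Rightarrow> nat \<Rightarrow> nat \<Rightarrow> (nat \<Rightarrow> nat set) \<Rightarrow> (nat \<Rightarrow> nat set) \<Rightarrow> (nat \<Rightarrow> 'a set) \<Rightarrow> bool"
  where
  "is_solution G r m L R A \<longleftrightarrow>
     disjoint_family_on A {1..r} \<and> (\<Union>k\<in>{1..r}. A k) = UNIV \<and>
     (\<forall>i\<in>{1..m}. \<exists>\<sigma>\<in>G. witnesses \<sigma> A (L i) (R i))"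

end

theory Submission
  imports Defs
begin

text \<open>Points receive labels \<open>1..r\<close>, and a congruence becomes a condition on the labels of \<open>y\<close> and
  \<open>f i y\<close>. For a weak, consistent and nonredundant system, the restrictions that a label imposes
  along a reduced walk die out after a bounded number of steps: such a walk traces a non-backtracking
  path in the graph of congruences, which is a forest. On a comeager set, where the action is free,
  one therefore keeps at each point a set of admissible labels such that any two admissible labels
  at the ends of a long walk can be joined by admissible ones along it; in any open set a
  nonmeager set with the property of Baire, sparse in every orbit, can be assigned one label without
  destroying this. After countably many steps almost every point has a single label. On
  the remaining invariant meager set the axiom of choice is used: by local commutativity each orbit
  is a tree or has exactly one cycle, and weakness makes the cycle labelable.\<close>

section \<open>Baire category\<close>

text \<open>Nonredundancy is what makes restrictions die out: if \<open>L i = R i\<close> is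
  nonempty and proper, membership in it is preserved along all powers of \<open>f i\<close>, so one
  label restricts others at unbounded distance. The first claim does not prescribe witnesses; hence
  a smallest subsystem from which all other nontrivial congruences are deducible is solved, and the
  remaining witnesses are composed from its witnesses. That subsystem may be empty, so the
  infinitude of \<open>G\<close>, which supplies the translates that carry the \<open>r\<close>
  labels at the start, is taken from the full free subgroup. The obstacle on the free part is that
  labels committed at several points of one orbit may be incompatible. A mixing constant
  \<open>M\<close> bounds how far a commitment is felt; new commitments are made only on sets whose
  points are more than \<open>5 * M\<close> apart in their orbits, so two of them never interfere.
  The constant starts at \<open>2 ^ r\<close>, the number of sets of labels, and a refinement turns
  \<open>M\<close> into \<open>4 * M\<close>. It need not stay bounded: the final labeling uses arc
  consistency at finite stages only.\<close>

lemma nowhere_dense_subset: "nowhere_dense T \<Longrightarrow> S \<subseteq> T \<Longrightarrow> nowhere_dense S"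
  unfolding nowhere_dense_def by (metis closure_mono interior_mono subset_empty)

lemma meagerI: "(\<And>n::nat. nowhere_dense (F n)) \<Longrightarrow> S = (\<Union>n. F n) \<Longrightarrow> meager S"
  unfolding meager_def by (intro exI[of _ F]) simp

lemma meager_subset:
  assumes "meager T" "S \<subseteq> T" shows "meager S"
proof -
  obtain F where F: "\<And>n::nat. nowhere_dense (F n)" "T = (\<Union>n. F n)"
    using assms(1) by (auto simp: meager_def)
  have "S = (\<Union>n. F n \<inter> S)" using F(2) assms(2) by auto
  moreover have "nowhere_dense (F n \<inter> S)" for n
    by (rule nowhere_dense_subset[OF F(1)]) auto
  ultimately show ?thesis by (intro meagerI)
qed

lemma meager_nowhere_dense: "nowhere_dense S \<Longrightarrow> meager S"
  unfolding meager_def by (intro exI[of _ "\<lambda>_. S"]) auto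

lemma meager_empty [simp]: "meager {}"
  by (simp add: meager_nowhere_dense nowhere_dense_def)

lemma meager_UN_nat:
  assumes "\<And>n::nat. meager (S n)" shows "meager (\<Union>n. S n)"
proof -
  have "\<forall>n. \<exists>F. (\<forall>k::nat. nowhere_dense (F k)) \<and> S n = (\<Union>k. F k)"
    using assms by (auto simp: meager_def)
  then obtain F where F: "\<And>n k::nat. nowhere_dense (F n k)" "\<And>n. S n = (\<Union>k. F n k)"
    by metis
  let ?G = "\<lambda>j. F (fst (prod_decode j)) (snd (prod_decode j))"
  have "x \<in> (\<Union>j. ?G j)" if "x \<in> F n k" for x n k
    using that by (intro UN_I[of "prod_encode (n, k)"]) simp_all
  then have "(\<Union>n. S n) = (\<Union>j. ?G j)" unfolding F(2) by blast
  then show ?thesis by (rule meagerI[rotated]) (rule F(1))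
qed

lemma meager_UN:
  assumes "countable J" "\<And>j. j \<in> J \<Longrightarrow> meager (S j)" shows "meager (\<Union>j\<in>J. S j)"
proof (cases "J = {}")
  case False
  then have "(\<Union>j\<in>J. S j) = (\<Union>n. S (from_nat_into J n))"
    using assms(1) by (metis image_image range_from_nat_into)
  then show ?thesis
    using assms(2) from_nat_into[OF False] by (auto intro: meager_UN_nat)
qed simp

lemma meager_Un: "meager S \<Longrightarrow> meager T \<Longrightarrow> meager (S \<union> T)"
  using meager_UN[of "{True, False}" "\<lambda>b. if b then S else T"] by (simp add: Un_commute)

lemma homeomorphism_UNIV_closure:
  assumes "homeomorphism UNIV UNIV g h"
  shows "closure (g ` S) = g ` closure S"
proof -
  have cg: "continuous_on UNIV g" and ch: "continuous_on UNIV h"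
    and hg: "\<And>x. h (g x) = x" and gh: "\<And>x. g (h x) = x"
    using assms by (auto simp: homeomorphism_def)
  have sub: "g ` closure S \<subseteq> closure (g ` S)" if "continuous_on UNIV g" for g :: "'c::topological_space \<Rightarrow> 'd::topological_space" and S
    by (rule image_closure_subset) (auto intro: continuous_on_subset[OF that] closure_subset[THEN subsetD])
  have "h ` closure (g ` S) \<subseteq> closure (h ` g ` S)" by (rule sub[OF ch])
  also have "h ` g ` S = S" by (simp add: image_image hg)
  finally have "closure (g ` S) \<subseteq> g ` closure S"
    using gh by (metis image_eqI image_subset_iff subsetI)
  with sub[OF cg, of S] show ?thesis by blast
qed

lemma homeomorphism_UNIV_open:
  assumes "homeomorphism UNIV UNIV g h" "open S" shows "open (g ` S)"
  using assms homeomorphism_imp_open_map[of UNIV UNIV g h S] by simp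

lemma meager_homeomorphic_image:
  assumes gh: "homeomorphism UNIV UNIV g h" and "meager S" shows "meager (g ` S)"
proof -
  obtain F where F: "\<And>n::nat. nowhere_dense (F n)" "S = (\<Union>n. F n)"
    using assms(2) by (auto simp: meager_def)
  have hg: "\<And>x. h (g x) = x" using gh by (auto simp: homeomorphism_def)
  have "nowhere_dense (g ` F n)" for n
  proof -
    let ?U = "interior (g ` closure (F n))"
    have "h ` ?U \<subseteq> closure (F n)" using interior_subset[of "g ` closure (F n)"] hg by auto
    moreover have "open (h ` ?U)"
      by (rule homeomorphism_UNIV_open[of h g]) (auto simp: homeomorphism_symD[OF gh])
    ultimately have "h ` ?U \<subseteq> interior (closure (F n))" by (rule interior_maximal)
    then show ?thesis
      using F(1)[of n] by (auto simp: nowhere_dense_def homeomorphism_UNIV_closure[OF gh])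
  qed
  moreover have "g ` S = (\<Union>n. g ` F n)" using F(2) by auto
  ultimately show ?thesis by (intro meagerI)
qed

lemma nowhere_dense_closure_diff: "open U \<Longrightarrow> nowhere_dense (closure U - U)"
proof -
  assume "open U"
  have "closed (closure U - U)" using \<open>open U\<close> by blast
  moreover have "interior (closure U - U) = {}"
  proof -
    have "interior (closure U - U) \<inter> U = {}" using interior_subset[of "closure U - U"] by blast
    then have "interior (closure U - U) \<inter> closure U = {}"
      using open_Int_closure_eq_empty[OF open_interior] by blast
    then show ?thesis using interior_subset[of "closure U - U"] by blast
  qed
  ultimately show ?thesis by (simp add: nowhere_dense_def)
qed

lemma baire_property_open: "open U \<Longrightarrow> baire_property U"
  unfolding baire_property_def by (intro exI[of _ U]) auto

lemma baire_property_meager: "meager S \<Longrightarrow> baire_property S"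
  unfolding baire_property_def by (intro exI[of _ "{}"]) auto

lemma baire_property_Compl:
  assumes "baire_property S" shows "baire_property (- S)"
proof -
  obtain U where U: "open U" "meager (sym_diff S U)" using assms by (auto simp: baire_property_def)
  have "sym_diff (- S) (- closure U) \<subseteq> sym_diff S U \<union> (closure U - U)"
    using closure_subset[of U, THEN subsetD] by blast
  then have "meager (sym_diff (- S) (- closure U))"
    by (rule meager_subset[rotated])
      (intro meager_Un U(2) meager_nowhere_dense nowhere_dense_closure_diff U(1))
  moreover have "open (- closure U)" by blast
  ultimately show ?thesis unfolding baire_property_def by blast
qed

lemma baire_property_UN:
  assumes "countable J" "\<And>j. j \<in> J \<Longrightarrow> baire_property (S j)" shows "baire_property (\<Union>j\<in>J. S j)"
proof -
  have "\<forall>j\<in>J. \<exists>U. open U \<and> meager (sym_diff (S j) U)"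
    using assms(2) by (simp add: baire_property_def)
  then obtain U where U: "\<And>j. j \<in> J \<Longrightarrow> open (U j)" "\<And>j. j \<in> J \<Longrightarrow> meager (sym_diff (S j) (U j))"
    by metis
  have "meager (\<Union>j\<in>J. sym_diff (S j) (U j))" by (rule meager_UN[OF assms(1) U(2)])
  then have "meager (sym_diff (\<Union>j\<in>J. S j) (\<Union>j\<in>J. U j))"
    by (rule meager_subset) blast
  moreover have "open (\<Union>j\<in>J. U j)" using U(1) by blast
  ultimately show ?thesis unfolding baire_property_def by blast
qed

lemma baire_property_Collect_not: "baire_property {x. P x} \<Longrightarrow> baire_property {x. \<not> P x}"
  using baire_property_Compl[of "{x. P x}"] by (simp add: Collect_neg_eq)

lemma baire_property_Collect_ex:
  "countable J \<Longrightarrow> (\<And>j. j \<in> J \<Longrightarrow> baire_property {x. P j x}) \<Longrightarrow> baire_property {x. \<exists>j\<in>J. P j x}"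
  using baire_property_UN[of J "\<lambda>j. {x. P j x}"] by (simp add: Collect_bex_eq)

lemma baire_property_Collect_disj:
  assumes "baire_property {x. P x}" "baire_property {x. Q x}"
  shows "baire_property {x. P x \<or> Q x}"
proof -
  have "baire_property (\<Union>S\<in>{{x. P x}, {x. Q x}}. S)"
    by (rule baire_property_UN) (use assms in auto)
  then show ?thesis by (simp add: Un_def)
qed

lemma baire_property_Collect_conj:
  "baire_property {x. P x} \<Longrightarrow> baire_property {x. Q x} \<Longrightarrow> baire_property {x. P x \<and> Q x}"
  using baire_property_Collect_not[OF baire_property_Collect_disj[of "\<lambda>x. \<not> P x" "\<lambda>x. \<not> Q x"]]
  by (simp add: baire_property_Collect_not)

lemma baire_property_Collect_all:
  assumes "countable J" "\<And>j. j \<in> J \<Longrightarrow> baire_property {x. P j x}"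
  shows "baire_property {x. \<forall>j\<in>J. P j x}"
  using baire_property_Collect_not[OF baire_property_Collect_ex[of J "\<lambda>j x. \<not> P j x"]] assms
  by (simp add: baire_property_Collect_not)

lemma baire_property_Collect_const: "baire_property {x. P}"
  by (cases P) (auto intro: baire_property_open)

lemma baire_property_homeomorphic_image:
  assumes gh: "homeomorphism UNIV UNIV g h" and "baire_property S" shows "baire_property (g ` S)"
proof -
  obtain U where U: "open U" "meager (sym_diff S U)" using assms by (auto simp: baire_property_def)
  have "inj g" by (metis gh homeomorphism_def UNIV_I injI)
  then have "sym_diff (g ` S) (g ` U) = g ` sym_diff S U" by (simp add: image_Un image_set_diff)
  then show ?thesis
    unfolding baire_property_def
    using homeomorphism_UNIV_open[OF gh U(1)] meager_homeomorphic_image[OF gh U(2)] by metis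
qed

lemma baire_property_Collect_homeomorphism:
  assumes gh: "homeomorphism UNIV UNIV g h" and "baire_property {x. P x}"
  shows "baire_property {x. P (g x)}"
proof -
  have "{x. P (g x)} = h ` {x. P x}"
    using gh by (auto simp: homeomorphism_def image_iff) metis
  then show ?thesis
    using baire_property_homeomorphic_image[OF homeomorphism_symD[OF gh] assms(2)] by simp
qed

lemma nonmeager_baire_property_imp_open:
  assumes "baire_property S" "\<not> meager S"
  obtains U where "open U" "U \<noteq> {}" "meager (U - S)"
proof -
  obtain U where U: "open U" "meager (sym_diff S U)" using assms by (auto simp: baire_property_def)
  have "U \<noteq> {}" using U(2) assms(2) by auto
  moreover have "meager (U - S)" by (rule meager_subset[OF U(2)]) blast
  ultimately show ?thesis using that U(1) by blast
qed

lemma nonmeager_open: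
  fixes U :: "'a::polish_space set"
  assumes "open U" "U \<noteq> {}" shows "\<not> meager U"
proof
  assume "meager U"
  then obtain F where F: "\<And>n::nat. nowhere_dense (F n)" "U = (\<Union>n. F n)"
    by (auto simp: meager_def)
  have "euclidean interior_of (\<Union>(range (\<lambda>n. closure (F n)))) = {}"
  proof (rule Baire_category_alt)
    show "completely_metrizable_space (euclidean :: 'a topology) \<or>
      locally_compact_space (euclidean :: 'a topology) \<and> regular_space (euclidean :: 'a topology)"
      by (simp add: completely_metrizable_space_euclidean)
  qed (use F(1) in \<open>auto simp: nowhere_dense_def closed_closedin[symmetric]\<close>)
  moreover have "U \<subseteq> interior (\<Union>n. closure (F n))"
    using F(2) closure_subset by (intro interior_maximal[OF _ assms(1)]) fastforce
  ultimately show False using assms(2) by simp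
qed

section \<open>Words and systems of congruences\<close>

type_synonym letter = "nat \<times> bool"

definition linv :: "letter \<Rightarrow> letter" where "linv l = (fst l, \<not> snd l)"

lemma linv_linv [simp]: "linv (linv l) = l"
  by (simp add: linv_def)

lemma fst_linv [simp]: "fst (linv l) = fst l"
  by (simp add: linv_def)

lemma linv_neq [simp]: "linv l \<noteq> l" "l \<noteq> linv l"
  by (auto simp: linv_def prod_eq_iff)

lemma linv_inject [simp]: "linv k = linv l \<longleftrightarrow> k = l"
  by (metis linv_linv)

lemma same_generator: "fst k = fst l \<Longrightarrow> k = l \<or> k = linv l"
  by (auto simp: linv_def prod_eq_iff)

lemma reduced_word_altdef: "reduced_word w \<longleftrightarrow> successively (\<lambda>k l. l \<noteq> linv k) w"
proof -
  have "(\<lambda>k l :: letter. \<not> (fst k = fst l \<and> snd k \<noteq> snd l)) = (\<lambda>k l. l \<noteq> linv k)"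
    by (auto simp: linv_def fun_eq_iff prod_eq_iff)
  then show ?thesis unfolding reduced_word_def by (rule arg_cong)
qed

definition red_word :: "nat set \<Rightarrow> letter list \<Rightarrow> bool" where
  "red_word I w \<longleftrightarrow> reduced_word w \<and> fst ` set w \<subseteq> I"

lemma red_word_Nil [simp]: "red_word I []"
  by (simp add: red_word_def reduced_word_def)

lemma red_word_append:
  "red_word I (u @ v) \<longleftrightarrow> red_word I u \<and> red_word I v \<and> (u = [] \<or> v = [] \<or> hd v \<noteq> linv (last u))"
  by (auto simp: red_word_def reduced_word_altdef successively_append_iff)

lemma red_word_Cons: "red_word I (l # w) \<longleftrightarrow> fst l \<in> I \<and> red_word I w \<and> (w = [] \<or> hd w \<noteq> linv l)"
  by (auto simp: red_word_def reduced_word_altdef successively_Cons)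

lemma red_word_conv_nth:
  "red_word I w \<longleftrightarrow> (\<forall>i<length w. fst (w ! i) \<in> I) \<and> (\<forall>i. Suc i < length w \<longrightarrow> w ! Suc i \<noteq> linv (w ! i))"
proof -
  have "fst ` set w \<subseteq> I \<longleftrightarrow> (\<forall>i<length w. fst (w ! i) \<in> I)"
    using nth_mem by (fastforce simp: in_set_conv_nth image_subset_iff)
  then show ?thesis by (auto simp: red_word_def reduced_word_altdef successively_conv_nth)
qed

definition winv :: "letter list \<Rightarrow> letter list" where "winv w = rev (map linv w)"

lemma winv_simps [simp]:
  "winv [] = []" "winv (u @ v) = winv v @ winv u" "winv w = [] \<longleftrightarrow> w = []"
  "length (winv w) = length w" "winv (winv w) = w" "winv (l # w) = winv w @ [linv l]"
  by (auto simp: winv_def rev_map o_def)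

lemma set_winv: "fst ` set (winv w) = fst ` set w"
  by (auto simp: winv_def image_image)

lemma red_word_winv [simp]: "red_word I (winv w) \<longleftrightarrow> red_word I w"
proof -
  have "red_word I (winv w)" if "red_word I w" for w
    using that
    by (induction w) (auto simp: red_word_append red_word_Cons winv_def last_rev hd_map)
  from this[of w] this[of "winv w"] show ?thesis by auto
qed

lemma last_winv: "w \<noteq> [] \<Longrightarrow> last (winv w) = linv (hd w)"
  by (simp add: winv_def last_rev hd_map)

lemma red_word_winv_append:
  assumes "red_word I u" "red_word I w" "u \<noteq> []" "w \<noteq> []" "hd u \<noteq> hd w" shows "red_word I (winv u @ w)"
  using assms by (simp add: red_word_append last_winv)

lemma finite_red_words:
  assumes "finite I" shows "finite {w. red_word I w \<and> length w \<le> n}"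
proof -
  have "finite {w. set w \<subseteq> I \<times> (UNIV :: bool set) \<and> length w \<le> n}"
    using assms by (intro finite_lists_length_le) auto
  then show ?thesis by (rule finite_subset[rotated]) (auto simp: red_word_def)
qed

declare One_nat_def [simp del]

section \<open>Congruence systems as constraints on labels\<close>

lemma deducible_sym: "deducible r C A B \<Longrightarrow> deducible r C B A"
  by (induction rule: deducible.induct) (auto intro: deducible.intros)

text \<open>The index set is an arbitrary \<open>I\<close>, so that the argument also applies to
  subsystems.\<close>

locale congruence_system =
  fixes r :: nat and I :: "nat set" and L R :: "nat \<Rightarrow> nat set"
  assumes r_pos: "r \<ge> 1"
    and sub: "\<And>i. i \<in> I \<Longrightarrow> L i \<subseteq> {1..r}" "\<And>i. i \<in> I \<Longrightarrow> R i \<subseteq> {1..r}"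
    and weak: "\<And>A. A \<subseteq> {1..r} \<Longrightarrow> \<not> deducible r (congs L R I) A ({1..r} - A)"
    and consistent: "\<And>A B. A \<subseteq> {1..r} \<Longrightarrow> B \<subset> A \<Longrightarrow> \<not> sub_deducible r (congs L R I) A B"
begin

abbreviation K :: "nat set" where "K \<equiv> {1..r}"

definition src :: "letter \<Rightarrow> nat set" where "src l = (if snd l then L (fst l) else R (fst l))"

definition tgt :: "letter \<Rightarrow> nat set" where "tgt l = (if snd l then R (fst l) else L (fst l))"

text \<open>Labels \<open>a\<close> and \<open>b\<close> may be given to \<open>y\<close> and to its image under the letter \<open>l\<close>.\<close>

definition step :: "letter \<Rightarrow> nat \<Rightarrow> nat \<Rightarrow> bool" where
  "step l a b \<longleftrightarrow> (a \<in> src l \<longleftrightarrow> b \<in> tgt l)"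

lemma src_linv [simp]: "src (linv l) = tgt l" and tgt_linv [simp]: "tgt (linv l) = src l"
  by (auto simp: src_def tgt_def linv_def)

lemma step_linv [simp]: "step (linv l) b a \<longleftrightarrow> step l a b"
  by (auto simp: step_def)

lemma src_sub: "fst l \<in> I \<Longrightarrow> src l \<subseteq> K" and tgt_sub: "fst l \<in> I \<Longrightarrow> tgt l \<subseteq> K"
  using sub by (auto simp: src_def tgt_def)

text \<open>The image of a nonempty set of labels, when not all of \<open>K\<close>, is always the
  right-hand side of one of these two pairs.\<close>

definition signed_cong :: "letter \<Rightarrow> nat set \<Rightarrow> nat set \<Rightarrow> bool" where
  "signed_cong l P Q \<longleftrightarrow> P = src l \<and> Q = tgt l \<or> P = K - src l \<and> Q = K - tgt l"

lemma signed_cong_linv [simp]: "signed_cong (linv l) Q P \<longleftrightarrow> signed_cong l P Q"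
  by (auto simp: signed_cong_def)

lemma signed_cong_deducible:
  assumes "signed_cong l P Q" "fst l \<in> J" shows "deducible r (congs L R J) P Q"
proof -
  have "(L (fst l), R (fst l)) \<in> congs L R J" using assms(2) by (auto simp: congs_def)
  then have "deducible r (congs L R J) (src l) (tgt l)"
    by (auto simp: src_def tgt_def intro: deducible.member deducible.member_sym)
  then show ?thesis using assms(1) by (auto simp: signed_cong_def intro: deducible.complement)
qed

lemma signed_cong_sub_deducible:
  assumes "signed_cong l P Q" "fst l \<in> I" shows "sub_deducible r (congs L R I) P Q"
proof -
  have "(L (fst l), R (fst l)) \<in> congs L R I" using assms(2) by (auto simp: congs_def)
  then show ?thesis
    using assms(1) by (auto simp: signed_cong_def src_def tgt_def split: if_splits
        intro: sub_deducible.left_right sub_deducible.right_left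
          sub_deducible.compl_left_right sub_deducible.compl_right_left)
qed

text \<open>If exactly one side were empty, the other would be subordinate to its proper subset
  \<open>{}\<close>, against consistency. \<open>src_full_iff\<close> is the dual case; together
  they exclude dead ends in \<open>step_total\<close>.\<close>

lemma src_empty_iff: "fst l \<in> I \<Longrightarrow> src l = {} \<longleftrightarrow> tgt l = {}"
proof -
  have *: "tgt l = {}" if "fst l \<in> I" "src l = {}" for l
  proof (rule ccontr)
    assume "tgt l \<noteq> {}"
    moreover have "sub_deducible r (congs L R I) (tgt l) (src l)"
      using signed_cong_sub_deducible[of "linv l"] that(1) by (auto simp: signed_cong_def)
    ultimately show False using consistent[of "tgt l" "src l"] tgt_sub[OF that(1)] that(2) by auto
  qed
  show "src l = {} \<longleftrightarrow> tgt l = {}" if "fst l \<in> I"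
    using *[of l] *[of "linv l"] that by auto
qed

lemma src_full_iff: "fst l \<in> I \<Longrightarrow> src l = K \<longleftrightarrow> tgt l = K"
proof -
  have *: "tgt l = K" if "fst l \<in> I" "src l = K" for l
  proof (rule ccontr)
    assume "tgt l \<noteq> K"
    moreover have "sub_deducible r (congs L R I) (src l) (tgt l)"
      using signed_cong_sub_deducible[of l] that(1) by (auto simp: signed_cong_def)
    ultimately show False using consistent[of "src l" "tgt l"] tgt_sub[OF that(1)] that(2) by auto
  qed
  show "src l = K \<longleftrightarrow> tgt l = K" if "fst l \<in> I"
    using *[of l] *[of "linv l"] that by auto
qed

lemma step_total: 
  assumes "fst l \<in> I" "a \<in> K" obtains b where "b \<in> K" "step l a b"
proof (cases "a \<in> src l")
  case True
  then obtain b where "b \<in> tgt l" using src_empty_iff[OF assms(1)] by blast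
  then show thesis using that tgt_sub[OF assms(1)] True by (auto simp: step_def)
next
  case False
  then have "tgt l \<noteq> K" using assms src_full_iff by blast
  then obtain b where "b \<in> K - tgt l" using tgt_sub[OF assms(1)] by blast
  then show thesis using that False by (auto simp: step_def)
qed

definition img :: "letter \<Rightarrow> nat set \<Rightarrow> nat set" where
  "img l T = {b\<in>K. \<exists>a\<in>T. step l a b}"

definition reach :: "letter list \<Rightarrow> nat set \<Rightarrow> nat set" where
  "reach w T = fold img w T"

lemma reach_simps [simp]: "reach [] T = T" "reach (l # w) T = reach w (img l T)"
  "reach (u @ v) T = reach v (reach u T)"
  by (auto simp: reach_def)

lemma img_sub: "img l T \<subseteq> K"
  by (auto simp: img_def)

lemma reach_sub: "T \<subseteq> K \<Longrightarrow> reach w T \<subseteq> K"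
  by (induction w arbitrary: T) (auto simp: img_sub)

lemma img_ne: 
  assumes "fst l \<in> I" "T \<subseteq> K" "T \<noteq> {}" shows "img l T \<noteq> {}"
proof -
  obtain a where a: "a \<in> T" "a \<in> K" using assms by blast
  obtain b where "b \<in> K" "step l a b" using step_total[OF assms(1) a(2)] .
  then have "b \<in> img l T" using a(1) by (auto simp: img_def)
  then show ?thesis by blast
qed

lemma reach_ne: "fst ` set w \<subseteq> I \<Longrightarrow> T \<subseteq> K \<Longrightarrow> T \<noteq> {} \<Longrightarrow> reach w T \<noteq> {}"
  by (induction w arbitrary: T) (auto simp: img_sub img_ne)

lemma img_full: "fst l \<in> I \<Longrightarrow> img l K = K"
proof -
  assume l: "fst l \<in> I"
  have "b \<in> img l K" if "b \<in> K" for b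
  proof -
    have "fst (linv l) \<in> I" using l by simp
    from step_total[OF this that] obtain a where "a \<in> K" "step (linv l) b a" .
    then show ?thesis using that by (auto simp: img_def)
  qed
  then show ?thesis using img_sub by blast
qed

lemma reach_full: "fst ` set w \<subseteq> I \<Longrightarrow> reach w K = K"
  by (induction w) (auto simp: img_full)

lemma img_Un: "img l (S \<union> T) = img l S \<union> img l T"
  by (auto simp: img_def)

lemma reach_Un: "reach w (S \<union> T) = reach w S \<union> reach w T"
  by (induction w arbitrary: S T) (auto simp: img_Un)

lemma reach_mono: "S \<subseteq> T \<Longrightarrow> reach w S \<subseteq> reach w T"
  using reach_Un[of w S T] by (simp add: subset_Un_eq)

lemma img_eq:
  assumes "fst l \<in> I"
  shows "img l T = (if T \<inter> src l = {} then {} else tgt l) \<union> (if T \<subseteq> src l then {} else K - tgt l)"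
  using tgt_sub[OF assms] by (auto simp: img_def step_def)

text \<open>If \<open>T\<close> meets both \<open>src l\<close> and its complement, then both
  \<open>tgt l\<close> and \<open>K - tgt l\<close> are reached. Otherwise \<open>T\<close> lies
  within one side \<open>P\<close>, and its image is exactly the corresponding side.\<close>

lemma img_neq_full:
  assumes "fst l \<in> I" "T \<subseteq> K" "T \<noteq> {}" "img l T \<noteq> K"
  obtains P where "T \<subseteq> P" "P \<subseteq> K" "signed_cong l P (img l T)"
proof (cases "T \<subseteq> src l")
  case True
  then have "img l T = tgt l" using assms by (auto simp: img_eq)
  then show thesis using that[of "src l"] True src_sub[OF assms(1)] by (auto simp: signed_cong_def)
next
  case False
  then have "T \<inter> src l = {}" using assms tgt_sub[OF assms(1)] by (auto simp: img_eq split: if_splits)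
  then have "img l T = K - tgt l" using False assms by (auto simp: img_eq)
  then show thesis using that[of "K - src l"] \<open>T \<inter> src l = {}\<close> assms(2) by (auto simp: signed_cong_def)
qed

text \<open>The images of \<open>T\<close> and \<open>K - T\<close> cover \<open>K\<close>, and an
  overlap would persist by \<open>reach_ne\<close>, so they stay complementary at each step. This
  forces \<open>T\<close> to be a side of the congruence of the first letter, and transitivity does
  the rest. The alternative \<open>reach w T = T\<close> serves the empty word.\<close>

lemma disjoint_reach_deducible:
  assumes "fst ` set w \<subseteq> I" "T \<subseteq> K" "T \<noteq> {}" "T \<noteq> K" "reach w T \<inter> reach w (K - T) = {}"
  shows "reach w T = T \<or> deducible r (congs L R I) T (reach w T)"
  using assms
proof (induction w arbitrary: T)
  case (Cons l w)
  have l: "fst l \<in> I" and w: "fst ` set w \<subseteq> I" using Cons.prems by auto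
  have dj: "reach w (img l T) \<inter> reach w (img l (K - T)) = {}" using Cons.prems by simp
  have neT: "K - T \<noteq> {}" using Cons.prems by blast
  have ne: "img l T \<noteq> {}" "img l (K - T) \<noteq> {}"
    using img_ne[OF l] Cons.prems neT by auto
  have un: "img l T \<union> img l (K - T) = K"
    using img_Un[of l T "K - T"] img_full[OF l] Cons.prems by (simp add: Un_absorb1)
  have "img l T \<inter> img l (K - T) = {}"
  proof (rule ccontr)
    assume *: "img l T \<inter> img l (K - T) \<noteq> {}" (is "?D \<noteq> _")
    have "reach w ?D \<subseteq> reach w (img l T)" "reach w ?D \<subseteq> reach w (img l (K - T))"
      by (intro reach_mono; blast)+
    moreover have "reach w ?D \<noteq> {}" using reach_ne[OF w _ *] img_sub by blast
    ultimately show False using dj by blast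
  qed
  with un have compl: "K - img l T = img l (K - T)" by blast
  have "img l T \<noteq> K" using compl ne(2) by blast
  then obtain P where P: "T \<subseteq> P" "P \<subseteq> K" "signed_cong l P (img l T)"
    using img_neq_full[OF l] Cons.prems by metis
  have "img l (K - T) \<noteq> K" using compl ne(1) img_sub by blast
  then obtain P' where P': "K - T \<subseteq> P'" "P' \<subseteq> K" "signed_cong l P' (K - img l T)"
    using img_neq_full[OF l _ neT] compl by (metis Diff_subset)
  \<comment> \<open>\<open>P\<close> and \<open>P'\<close> belong to complementary images under the
    same letter, hence are complementary; as they contain \<open>T\<close> and \<open>K - T\<close>,
    both inclusions are equalities.\<close>
  have "T = P"
  proof (rule ccontr)
    assume "T \<noteq> P"
    with P obtain x where x: "x \<in> P" "x \<in> P'" using P' by blast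
    show False
      using P(3) P'(3) x ne(1) \<open>img l T \<noteq> K\<close> img_sub[of l T] src_full_iff[OF l] src_empty_iff[OF l] tgt_sub[OF l]
      by (auto simp: signed_cong_def)
  qed
  then have d: "deducible r (congs L R I) T (img l T)" using signed_cong_deducible[OF P(3) l] by simp
  show ?case
    using Cons.IH[OF w img_sub ne(1) \<open>img l T \<noteq> K\<close>] dj compl d by (auto intro: deducible.transitive)
qed simp

text \<open>R. Robinson's lemma: weakness makes every closed walk labelable.\<close>

lemma exists_label_cycle:
  assumes "fst ` set w \<subseteq> I" "w \<noteq> []" shows "\<exists>s\<in>K. s \<in> reach w {s}"
proof (rule ccontr)
  assume *: "\<not> ?thesis"
  obtain l w' where w: "w = l # w'" using assms(2) by (cases w) auto
  have l: "fst l \<in> I" using assms w by auto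
  let ?P = "src l"
  have PK: "?P \<subseteq> K" by (rule src_sub[OF l])
  \<comment> \<open>\<open>reach w {s}\<close> depends only on the side of \<open>src l\<close>
    containing \<open>s\<close>. If no label returns, each side is mapped off itself; since the
    images cover \<open>K\<close>, the two sides are exchanged, which is a congruence of
    \<open>?P\<close> with its complement.\<close>
  have "img l {s} = img l ?P" if "s \<in> ?P" for s
    using that PK by (auto simp: img_eq[OF l])
  then have 1: "reach w ?P \<inter> ?P = {}" using * PK by (fastforce simp: w)
  have "img l {s} = img l (K - ?P)" if "s \<in> K - ?P" for s
  proof -
    have "(K - ?P) \<inter> ?P = {}" "\<not> K - ?P \<subseteq> ?P" using that by blast+
    then show ?thesis using that by (simp add: img_eq[OF l])
  qed
  then have "reach w {s} = reach w (K - ?P)" if "s \<in> K - ?P" for s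
    using that by (simp add: w)
  then have 2: "reach w (K - ?P) \<inter> (K - ?P) = {}" using * by blast
  have "reach w ?P \<union> reach w (K - ?P) = K"
    using reach_Un[of w ?P "K - ?P"] reach_full[OF assms(1)] PK by (simp add: Un_absorb1)
  then have eq: "reach w ?P = K - ?P" "reach w (K - ?P) = ?P"
    using 1 2 PK reach_sub[of ?P w] reach_sub[of "K - ?P" w] by blast+
  have "K \<noteq> {}" using r_pos by simp
  have "reach w {} = {}"
    by (induction w) (auto simp: img_def)
  then have "?P \<noteq> {}" using eq \<open>K \<noteq> {}\<close> by auto
  moreover have "?P \<noteq> K" using eq \<open>K \<noteq> {}\<close> \<open>reach w {} = {}\<close> by auto
  ultimately have "reach w ?P = ?P \<or> deducible r (congs L R I) ?P (K - ?P)"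
    using disjoint_reach_deducible[OF assms(1) PK] eq by auto
  then show False using eq(1) weak[OF PK] \<open>?P \<noteq> {}\<close> by blast
qed

lemma signed_cong_inject:
  assumes "fst l \<in> I" "signed_cong l P Q" "signed_cong l P' Q'"
  shows "P = P' \<and> Q = Q' \<or> P' = K - P \<and> Q' = K - Q"
  using assms(2,3) src_sub[OF assms(1)] tgt_sub[OF assms(1)] by (auto simp: signed_cong_def double_diff)

text \<open>\<open>J\<close> is separate from \<open>I\<close> so that one congruence can be left
  out, as nonredundancy requires.\<close>

lemma signed_cong_chain_deducible:
  assumes "i < j" "\<And>k. i \<le> k \<Longrightarrow> k < j \<Longrightarrow> signed_cong (e k) (T k) (T (Suc k)) \<and> fst (e k) \<in> J"
  shows "deducible r (congs L R J) (T i) (T j)"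
  using assms
proof (induction j)
  case (Suc j)
  have last: "deducible r (congs L R J) (T j) (T (Suc j))"
    using Suc.prems(1) Suc.prems(2)[of j] by (auto intro: signed_cong_deducible)
  show ?case
  proof (cases "i = j")
    case False
    then show ?thesis using Suc last by (auto intro: deducible.transitive)
  qed (use last in auto)
qed simp

end

section \<open>Nonredundant systems: how far the influence of a label extends\<close>

locale nonredundant_congruence_system = congruence_system +
  assumes nonredundant: "\<And>i. i \<in> I \<Longrightarrow> \<not> deducible r (congs L R (I - {i})) (L i) (R i)"
    and nontrivial: "\<And>i. i \<in> I \<Longrightarrow> L i \<noteq> R i"
begin

text \<open>The graph with the sets of labels (up to complement) as vertices and the congruences as edges
  is a forest, so a walk in it that does not backtrack is not closed.\<close>

lemma no_closed_chain:
  assumes "a < b" "T a = T b"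
    and "\<And>k. a \<le> k \<Longrightarrow> k < b \<Longrightarrow> signed_cong (e k) (T k) (T (Suc k)) \<and> fst (e k) \<in> I \<and> T k \<subseteq> K"
    and "\<And>k. a \<le> k \<Longrightarrow> Suc k < b \<Longrightarrow> e (Suc k) \<noteq> linv (e k)"
  shows False
  using assms
proof (induction "b - a" arbitrary: a b rule: less_induct)
  case less
  \<comment> \<open>Induction on the length: a shorter closed piece inside is already
    contradictory.\<close>
  have dist: "T i \<noteq> T j" if "a \<le> i" "i < j" "j \<le> b" "j - i < b - a" for i j
  proof
    assume "T i = T j"
    then show False using that less.prems(3,4) by (intro less.hyps[of j i]) auto
  qed
  obtain c where b: "b = Suc c" using less.prems(1) by (cases b) auto
  define l where "l = e c"
  have sc: "signed_cong l (T c) (T b)" and l: "fst l \<in> I" and Tc: "T c \<subseteq> K"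
    using less.prems(3)[of c] less.prems(1) by (auto simp: b l_def)
  have Tb: "T b \<subseteq> K" using less.prems(1,2) less.prems(3)[of a] by auto
  show False
  \<comment> \<open>Does the generator of the last edge \<open>l\<close> occur earlier, at
    \<open>k\<close>? In the same direction, \<open>T c\<close> is either \<open>T k\<close>,
    excluded by minimality, or its complement, excluded by weakness. In the opposite direction,
    either \<open>T b\<close> is the complement of \<open>T k\<close>, or
    \<open>T (Suc k) = T c\<close>, which forces \<open>Suc k = c\<close> and hence
    backtracking.\<close>
  proof (cases "\<exists>k. a \<le> k \<and> k < c \<and> fst (e k) = fst l")
    case True
    then obtain k where k: "a \<le> k" "k < c" "fst (e k) = fst l" by blast
    have sk: "signed_cong (e k) (T k) (T (Suc k))" and Tk: "T k \<subseteq> K" using less.prems(3)[of k] k b by auto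
    have ded: "deducible r (congs L R I) (T k) (T j)" if "k < j" "j \<le> b" for j
      by (rule signed_cong_chain_deducible[of k j e]) (use that k(1) less.prems(3) in auto)
    consider "e k = l" | "e k = linv l" using same_generator[OF k(3)] by blast
    then show False
    proof cases
      case 1
      have "T k \<noteq> T c" using dist[of k c] k b by auto
      then have "T c = K - T k" using signed_cong_inject[OF l sk[unfolded 1] sc] by auto
      then show False using ded[of c] k b weak[OF Tk] by auto
    next
      case 2
      then have sk': "signed_cong l (T (Suc k)) (T k)" using sk by simp
      show False
      proof (cases "T b = K - T k")
        case True
        then show False using ded[of b] k b weak[OF Tk] by auto
      next
        case False
        then have "T (Suc k) = T c" using signed_cong_inject[OF l sk' sc] by auto
        then have "Suc k = c" using dist[of "Suc k" c] k b by (cases "Suc k = c") auto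
        then show False using less.prems(4)[of k] k b 2 by (auto simp: l_def)
      qed
    qed
  next
    case False
    \<comment> \<open>The rest of the closed chain avoids this generator, so it deduces the last
      congruence from the others; if \<open>a = c\<close> there is no rest, and the congruence has
      equal sides.\<close>
    let ?C = "congs L R (I - {fst l})"
    have "deducible r ?C (T b) (T c) \<or> T b = T c"
    proof (cases "a = c")
      case a: False
      have "deducible r ?C (T a) (T c)"
        by (rule signed_cong_chain_deducible[of a c e]) (use a less.prems(1,3) False b in auto)
      then show ?thesis using less.prems(2) by simp
    qed (use less.prems in auto)
    then have "deducible r ?C (tgt l) (src l) \<or> tgt l = src l"
      using sc
    proof (elim disjE)
      assume d: "deducible r ?C (T b) (T c)"
      have "K - (K - src l) = src l" "K - (K - tgt l) = tgt l"
        using src_sub[OF l] tgt_sub[OF l] by auto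
      then show ?thesis using d deducible.complement[OF d] sc by (auto simp: signed_cong_def)
    next
      assume "T b = T c"
      then have "tgt l = src l" using sc src_sub[OF l] tgt_sub[OF l] by (auto simp: signed_cong_def)
      then show ?thesis by simp
    qed
    then show False
      using nonredundant[OF l] nontrivial[OF l] deducible_sym
      by (auto simp: src_def tgt_def split: if_splits)
  qed
qed

text \<open>While not every label is reachable, each step maps the set of reachable labels into one side
  of a congruence. By pigeonhole such a set recurs; consistency forbids any strict inclusion in
  between, so that a closed walk as excluded by the previous lemma arises.\<close>

lemma reach_eventually_full:
  assumes "red_word I w" "length w \<ge> 2 ^ r" "s \<in> K"
  shows "reach w {s} = K"
proof (rule ccontr)
  assume nf: "reach w {s} \<noteq> K"
  define n where "n = length w"
  define T where "T j = reach (take j w) {s}" for j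
  have wI: "fst ` set w \<subseteq> I" using assms(1) by (simp add: red_word_def)
  have wtI: "fst ` set (take j w) \<subseteq> I" "fst ` set (drop j w) \<subseteq> I" for j
    using wI set_take_subset[of j w] set_drop_subset[of j w] by blast+
  have TK: "T j \<subseteq> K" for j unfolding T_def using assms(3) by (intro reach_sub) auto
  have Tne: "T j \<noteq> {}" for j unfolding T_def using assms(3) wtI by (intro reach_ne) auto
  have Tnf: "T j \<noteq> K" for j
  proof
    assume "T j = K"
    then have "reach (take j w @ drop j w) {s} = K"
      using reach_full[OF wtI(2)[of j]] unfolding T_def by (simp only: reach_simps)
    then show False using nf by simp
  qed
  have TS: "T (Suc j) = img (w ! j) (T j)" if "j < n" for j
    using that unfolding T_def n_def by (simp only: take_Suc_conv_app_nth reach_simps)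
  have wj: "fst (w ! j) \<in> I" if "j < n" for j using wI that by (auto simp: n_def)
  \<comment> \<open>\<open>P j\<close> is the side of the congruence that contains
    \<open>T j\<close>, possibly strictly.\<close>
  have "\<exists>P. T j \<subseteq> P \<and> P \<subseteq> K \<and> signed_cong (w ! j) P (T (Suc j))" if "j < n" for j
    using img_neq_full[OF wj[OF that] TK Tne] TS[OF that] Tnf[of "Suc j"] by metis
  then obtain P where P: "\<And>j. j < n \<Longrightarrow> T j \<subseteq> P j" "\<And>j. j < n \<Longrightarrow> P j \<subseteq> K"
    "\<And>j. j < n \<Longrightarrow> signed_cong (w ! j) (P j) (T (Suc j))"
    by metis
  let ?sd = "sub_deducible r (congs L R I)"
  have sdP: "?sd (P j) (T (Suc j))" if "j < n" for j
    using signed_cong_sub_deducible[OF P(3) wj] that by blast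
  have sdT: "?sd (T i) (T j)" if "i \<le> j" "j \<le> n" for i j
    using that
  proof (induction j)
    case (Suc j)
    show ?case
    proof (cases "i = Suc j")
      case False
      have "?sd (T j) (P j)" using Suc.prems P TK by (intro sub_deducible.subset) auto
      then show ?thesis using Suc False sdP[of j] by (auto intro: sub_deducible.transitive)
    qed (use TK in \<open>auto intro: sub_deducible.subset\<close>)
  qed (use TK in \<open>auto intro: sub_deducible.subset\<close>)
  \<comment> \<open>The walk visits \<open>n + 1 > 2 ^ r\<close> sets, more than there are sets of
    labels.\<close>
  have "card (T ` {0..n}) \<le> card (Pow K)" using TK by (intro card_mono) auto
  also have "\<dots> < card {0..n}" using assms(2) by (simp add: card_Pow n_def)
  finally have "\<not> inj_on T {0..n}" using card_image by fastforce
  then obtain i j where "i \<in> {0..n}" "j \<in> {0..n}" "i \<noteq> j" "T i = T j" by (auto simp: inj_on_def)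
  then obtain a b where ab: "a < b" "b \<le> n" "T a = T b"
    by (metis atLeastAtMost_iff linorder_neqE_nat)
  \<comment> \<open>Going once around, \<open>P k\<close> is subordinate to
    \<open>T (Suc k)\<close>, then to \<open>T b = T a\<close>, then to \<open>T k\<close>; a strict
    inclusion of \<open>T k\<close> in \<open>P k\<close> would violate consistency.\<close>
  have TP: "T k = P k" if "a \<le> k" "k < b" for k
  proof (rule ccontr)
    assume "T k \<noteq> P k"
    then have "T k \<subset> P k" using P(1)[of k] that ab by auto
    moreover have "?sd (P k) (T k)"
      using sdP[of k] sdT[of "Suc k" b] sdT[of a k] that ab by (auto intro: sub_deducible.transitive)
    ultimately show False using consistent P(2)[of k] that ab by auto
  qed
  show False
  proof (rule no_closed_chain[of a b T "\<lambda>k. w ! k"])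
    show "signed_cong (w ! k) (T k) (T (Suc k)) \<and> fst (w ! k) \<in> I \<and> T k \<subseteq> K" if "a \<le> k" "k < b" for k
      using P(3)[of k] TP[OF that] wj[of k] TK that ab by auto
    show "w ! Suc k \<noteq> linv (w ! k)" if "a \<le> k" "Suc k < b" for k
      using assms(1) that ab by (simp add: red_word_conv_nth n_def)
  qed (use ab in auto)
qed

end

section \<open>Labels on the free part\<close>

locale congruence_action = congruence_system +
  fixes act :: "letter \<Rightarrow> 'a \<Rightarrow> 'a"
  assumes act_linv [simp]: "act (linv l) (act l y) = y"
begin

lemma act_linv' [simp]: "act l (act (linv l) y) = y"
  using act_linv[of "linv l"] by simp

abbreviation walk :: "letter list \<Rightarrow> 'a \<Rightarrow> 'a" where "walk \<equiv> fold act"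

lemma walk_winv [simp]: "walk (winv w) (walk w y) = y"
  by (induction w arbitrary: y) auto

lemma walk_winv' [simp]: "walk w (walk (winv w) y) = y"
  using walk_winv[of "winv w"] by simp

lemma exists_reduced:
  assumes "fst ` set w \<subseteq> I"
  obtains u where "red_word I u" "length u \<le> length w" "walk u = walk w"
proof -
  have "\<exists>u. red_word I u \<and> length u \<le> length w \<and> walk u = walk w"
    using assms
  proof (induction w)
    case (Cons l w)
    then obtain u where u: "red_word I u" "length u \<le> length w" "walk u = walk w" by auto
    show ?case
    proof (cases "u \<noteq> [] \<and> hd u = linv l")
      case True
      then obtain u' where u': "u = linv l # u'" by (cases u) auto
      have "walk u' = walk (l # w)"
      proof
        fix y
        have "walk (l # w) y = walk u (act l y)" using u(3) by simp
        then show "walk u' y = walk (l # w) y" using u' by simp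
      qed
      then show ?thesis using u u' by (intro exI[of _ u']) (auto simp: red_word_Cons)
    next
      case False
      then show ?thesis using u Cons.prems by (intro exI[of _ "l # u"]) (auto simp: red_word_Cons)
    qed
  qed auto
  then show thesis using that by blast
qed

text \<open>\<open>S\<close> gives the set of labels that a point may still receive. A chain for \<open>S\<close> is a labeling
  of the points on a walk by labels that are still allowed and respect the congruences.\<close>

fun chain :: "('a \<Rightarrow> nat set) \<Rightarrow> letter list \<Rightarrow> 'a \<Rightarrow> nat \<Rightarrow> nat \<Rightarrow> bool" where
  "chain S [] y s t \<longleftrightarrow> s = t"
| "chain S (l # w) y s t \<longleftrightarrow> (\<exists>u\<in>S (act l y). step l s u \<and> chain S w (act l y) u t)"

lemma chain_append:
  "chain S (u @ v) y s t \<longleftrightarrow> (\<exists>x. chain S u y s x \<and> chain S v (walk u y) x t)"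
  by (induction u arbitrary: y s) auto

lemma chain_end: "chain S w y s t \<Longrightarrow> s \<in> S y \<Longrightarrow> t \<in> S (walk w y)"
  by (induction w arbitrary: y s) auto

lemma chain_cong:
  "(\<And>j. j \<le> length w \<Longrightarrow> S (walk (take j w) y) = S' (walk (take j w) y)) \<Longrightarrow>
    chain S w y s t \<longleftrightarrow> chain S' w y s t"
proof (induction w arbitrary: y s)
  case (Cons l w)
  have "S (walk (take j w) (act l y)) = S' (walk (take j w) (act l y))" if "j \<le> length w" for j
    using Cons.prems[of "Suc j"] that by simp
  from Cons.IH[OF this] this[of 0] show ?case by simp
qed simp

end

locale free_congruence_action =
  nonredundant_congruence_system r I L R + congruence_action r I L R act
  for r I L R and act :: "letter \<Rightarrow> 'a \<Rightarrow> 'a" +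
  fixes D :: "'a set"
  assumes act_D: "y \<in> D \<Longrightarrow> fst l \<in> I \<Longrightarrow> act l y \<in> D"
    and free: "y \<in> D \<Longrightarrow> red_word I w \<Longrightarrow> w \<noteq> [] \<Longrightarrow> walk w y \<noteq> y"
begin

lemma walk_D: "y \<in> D \<Longrightarrow> fst ` set w \<subseteq> I \<Longrightarrow> walk w y \<in> D"
  by (induction w arbitrary: y) (auto simp: act_D)

lemma walk_D_red_word: "y \<in> D \<Longrightarrow> red_word I w \<Longrightarrow> walk w y \<in> D"
  by (simp add: red_word_def walk_D)

text \<open>After cancelling a common prefix, \<open>winv u @ w\<close> would be a nonempty reduced
  word fixing a point of \<open>D\<close>. So orbits in \<open>D\<close> are trees.\<close>

lemma walk_inject:
  assumes "y \<in> D" "red_word I u" "red_word I w" "walk u y = walk w y" shows "u = w"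
  using assms
proof (induction u arbitrary: y w)
  case Nil
  then show ?case using free[of y w] by (cases "w = []") auto
next
  case (Cons l u)
  show ?case
  proof (cases w)
    case Nil
    then show ?thesis using free[of y "l # u"] Cons.prems by simp
  next
    case w: (Cons k w')
    have "l = k"
    proof (rule ccontr)
      assume "l \<noteq> k"
      then have "red_word I (winv (l # u) @ w)" using Cons.prems w by (intro red_word_winv_append) auto
      moreover have "walk (winv (l # u) @ w) (walk (l # u) y) = walk (l # u) y"
        using Cons.prems(4) walk_winv[of "l # u" y] by (simp only: fold_append o_apply)
      ultimately show False using free[OF walk_D_red_word[OF Cons.prems(1,2)]] w by blast
    qed
    then show ?thesis using Cons.IH[of "act l y" w'] Cons.prems w by (auto simp: red_word_Cons act_D)
  qed
qed

section \<open>Admissible sets of labels, mixing, and refinement by sparse commitments\<close>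

definition arc_consistent :: "('a \<Rightarrow> nat set) \<Rightarrow> bool" where
  "arc_consistent S \<longleftrightarrow> (\<forall>y\<in>D. \<forall>l. fst l \<in> I \<longrightarrow> (\<forall>s\<in>S y. \<exists>t\<in>S (act l y). step l s t))"

definition mixing :: "nat \<Rightarrow> ('a \<Rightarrow> nat set) \<Rightarrow> bool" where
  "mixing M S \<longleftrightarrow> (\<forall>y\<in>D. \<forall>w. red_word I w \<and> M \<le> length w \<longrightarrow>
     (\<forall>s\<in>S y. \<forall>t\<in>S (walk w y). chain S w y s t))"

definition label_domain :: "('a \<Rightarrow> nat set) \<Rightarrow> bool" where
  "label_domain S \<longleftrightarrow> (\<forall>y\<in>D. S y \<noteq> {} \<and> S y \<subseteq> K) \<and> arc_consistent S"

lemma arc_consistentE: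
  assumes "arc_consistent S" "y \<in> D" "fst l \<in> I" "s \<in> S y"
  obtains t where "t \<in> S (act l y)" "step l s t"
  using assms unfolding arc_consistent_def by blast

lemma chain_forward:
  "arc_consistent S \<Longrightarrow> y \<in> D \<Longrightarrow> fst ` set w \<subseteq> I \<Longrightarrow> s \<in> S y \<Longrightarrow> \<exists>t\<in>S (walk w y). chain S w y s t"
proof (induction w arbitrary: y s)
  case (Cons l w)
  obtain u where u: "u \<in> S (act l y)" "step l s u"
    using Cons.prems by (auto elim: arc_consistentE[of S y l s])
  have "\<exists>t\<in>S (walk w (act l y)). chain S w (act l y) u t"
    using Cons u by (intro Cons.IH) (auto simp: act_D)
  then show ?case using u by auto
qed auto

text \<open>Arc consistency is required for inverse letters too, so an admissible label at the far
  end can be traced back.\<close>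

lemma chain_backward:
  "arc_consistent S \<Longrightarrow> y \<in> D \<Longrightarrow> fst ` set w \<subseteq> I \<Longrightarrow> t \<in> S (walk w y) \<Longrightarrow> \<exists>s\<in>S y. chain S w y s t"
proof (induction w arbitrary: y)
  case (Cons l w)
  have D: "act l y \<in> D" and l: "fst (linv l) \<in> I" using Cons.prems by (auto simp: act_D)
  have "\<exists>u\<in>S (act l y). chain S w (act l y) u t"
    using Cons D by (intro Cons.IH) auto
  then obtain u where u: "u \<in> S (act l y)" "chain S w (act l y) u t" by blast
  obtain s where "s \<in> S (act (linv l) (act l y))" "step (linv l) u s"
    using arc_consistentE[OF Cons.prems(1) D l u(1)] .
  then show ?case using u by auto
qed auto

lemma chain_const: "s \<in> K \<Longrightarrow> chain (\<lambda>_. K) w y s t \<longleftrightarrow> t \<in> reach w {s}"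
proof -
  have "(\<exists>s\<in>T. chain (\<lambda>_. K) w y s t) \<longleftrightarrow> t \<in> reach w T" if "T \<subseteq> K" for T
    using that
  proof (induction w arbitrary: y T)
    case (Cons l w)
    have "(\<exists>s\<in>T. chain (\<lambda>_. K) (l # w) y s t) \<longleftrightarrow> (\<exists>u\<in>img l T. chain (\<lambda>_. K) w (act l y) u t)"
      unfolding img_def chain.simps by blast
    then show ?case using Cons.IH[OF img_sub] by simp
  qed auto
  from this[of "{s}"] show "s \<in> K \<Longrightarrow> ?thesis" by simp
qed

lemma label_domain_const: "label_domain (\<lambda>_. K)"
proof -
  have "K \<noteq> {}" using r_pos by simp
  then show ?thesis
    unfolding label_domain_def arc_consistent_def using step_total by blast
qed

lemma mixing_const: "mixing (2 ^ r) (\<lambda>_. K)"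
  unfolding mixing_def using reach_eventually_full chain_const by simp

text \<open>What is left of \<open>S\<close> when the points of \<open>V\<close> receive the labels \<open>\<kappa>\<close>. If \<open>S\<close> is mixing and \<open>V\<close> is
  sparse, then each point feels at most one point of \<open>V\<close>, and mixing survives with a worse constant.\<close>

definition refine :: "('a \<Rightarrow> nat set) \<Rightarrow> 'a set \<Rightarrow> ('a \<Rightarrow> nat) \<Rightarrow> 'a \<Rightarrow> nat set" where
  "refine S V \<kappa> y = {s \<in> S y. \<forall>w. red_word I w \<longrightarrow> walk (winv w) y \<in> V \<longrightarrow>
     chain S w (walk (winv w) y) (\<kappa> (walk (winv w) y)) s}"

lemma refine_sub: "refine S V \<kappa> y \<subseteq> S y"
  by (auto simp: refine_def)

text \<open>The factor \<open>5\<close>: two points that are each reached from \<open>V\<close> by a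
  walk shorter than \<open>M\<close>, and are joined by a walk of length at most
  \<open>3 * M\<close>, must be reached from the same point of \<open>V\<close>.\<close>

context
  fixes S :: "'a \<Rightarrow> nat set" and M :: nat and V :: "'a set" and \<kappa> :: "'a \<Rightarrow> nat"
  assumes S: "label_domain S" "mixing M S"
    and V: "V \<subseteq> D" "\<And>v. v \<in> V \<Longrightarrow> \<kappa> v \<in> S v"
    and sparse: "\<And>v w. v \<in> V \<Longrightarrow> red_word I w \<Longrightarrow> w \<noteq> [] \<Longrightarrow> length w \<le> 5 * M \<Longrightarrow> walk w v \<notin> V"
begin

private abbreviation "S' \<equiv> refine S V \<kappa>"

text \<open>\<open>refine\<close> pulls \<open>V\<close> back along fixed words, which suits the
  property of Baire; the combinatorics is easier to see from the points of \<open>V\<close>.\<close>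

private lemma mem_refine_iff:
  "s \<in> S' y \<longleftrightarrow> s \<in> S y \<and> (\<forall>v\<in>V. \<forall>w. red_word I w \<longrightarrow> walk w v = y \<longrightarrow> chain S w v (\<kappa> v) s)"
proof -
  have "walk w v = y \<longleftrightarrow> v = walk (winv w) y" for w v by auto
  then show ?thesis by (auto simp: refine_def)
qed

private lemma far_chain:
  assumes "v \<in> V" "red_word I w" "M \<le> length w" "s \<in> S (walk w v)" shows "chain S w v (\<kappa> v) s"
  using S(2) V assms unfolding mixing_def by blast

private lemma near_unique:
  assumes "v \<in> V" "red_word I w" "length w < M" "v' \<in> V" "red_word I w'" "length w' < M" "walk w v = walk w' v'"
  shows "v = v' \<and> w = w'"
proof -
  have "fst ` set (w @ winv w') \<subseteq> I" using assms by (simp add: red_word_def image_Un set_winv)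
  then obtain u where u: "red_word I u" "length u \<le> length (w @ winv w')" "walk u = walk (w @ winv w')"
    by (rule exists_reduced)
  have "walk u v = v'" using u(3) assms(7) by simp
  moreover have "length u \<le> 5 * M" using u(2) assms by simp
  ultimately have "u = []" using sparse[of v u] u(1) assms by auto
  then have "v = v'" using \<open>walk u v = v'\<close> by simp
  then show ?thesis using walk_inject[of v w w'] assms V by auto
qed

text \<open>The walk from \<open>V\<close> to \<open>y\<close> of length less than \<open>M\<close>, if there is one, is the only constraint.\<close>

private lemma mem_refine_near:
  assumes "v \<in> V" "red_word I w" "length w < M" "chain S w v (\<kappa> v) s"
  shows "s \<in> S' (walk w v)"
proof -
  have "s \<in> S (walk w v)" using chain_end assms V by blast
  moreover have "chain S w' v' (\<kappa> v') s" if "v' \<in> V" "red_word I w'" "walk w' v' = walk w v" for v' w'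
    using near_unique[of v' w' v w] far_chain[of v' w' s] that assms calculation
    by (cases "length w' < M") auto
  ultimately show ?thesis unfolding mem_refine_iff by blast
qed

private definition near :: "'a \<Rightarrow> bool" where
  "near z \<longleftrightarrow> (\<exists>v\<in>V. \<exists>u. red_word I u \<and> length u < M \<and> walk u v = z)"

private lemma refine_far:
  assumes "\<not> near z" shows "S' z = S z"
proof -
  have "s \<in> S' z" if "s \<in> S z" for s
    unfolding mem_refine_iff
  proof (intro conjI ballI allI impI that)
    fix v w assume *: "v \<in> V" "red_word I w" "walk w v = z"
    then have "M \<le> length w" using assms by (auto simp: near_def not_less)
    then show "chain S w v (\<kappa> v) s" using far_chain * that by blast
  qed
  then show ?thesis using refine_sub[of S V \<kappa> z] by blast
qed

text \<open>The empty word forces \<open>\<kappa> v\<close>; all other constraints come along walks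
  longer than \<open>5 * M\<close>, and mixing satisfies those.\<close>

lemma refine_eq_singleton:
  assumes "v \<in> V" shows "refine S V \<kappa> v = {\<kappa> v}"
proof -
  have "\<kappa> v \<in> S' v"
    unfolding mem_refine_iff
  proof (intro conjI ballI allI impI)
    fix v' w assume *: "v' \<in> V" "red_word I w" "walk w v' = v"
    show "chain S w v' (\<kappa> v') (\<kappa> v)"
    proof (cases "w = []")
      case False
      then have "length w > 5 * M" using sparse[OF *(1,2) False] *(3) assms by (cases "length w \<le> 5 * M") auto
      then show ?thesis using far_chain[OF *(1,2)] V assms * by auto
    qed (use * in auto)
  qed (use V assms in auto)
  moreover have "s = \<kappa> v" if "s \<in> S' v" for s
    using that assms red_word_Nil[of I] unfolding mem_refine_iff by (metis chain.simps(1) fold_simps(1))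
  ultimately show ?thesis by blast
qed

private lemma refine_nonempty: 
  assumes "y \<in> D" shows "S' y \<noteq> {}"
proof (cases "near y")
  case True
  then obtain v u where vu: "v \<in> V" "red_word I u" "length u < M" "walk u v = y" by (auto simp: near_def)
  obtain s where "chain S u v (\<kappa> v) s"
    using chain_forward[of S v u "\<kappa> v"] S V vu by (auto simp: label_domain_def red_word_def)
  then show ?thesis using mem_refine_near[OF vu(1-3)] vu(4) by blast
next
  case False
  then show ?thesis using refine_far assms S by (auto simp: label_domain_def)
qed

text \<open>Let \<open>u\<close> be a short walk from \<open>V\<close> to \<open>act l y\<close>.
  Either it ends with \<open>l\<close>, so \<open>y\<close> is its last but one point and the chain
  to \<open>y\<close> extends by \<open>t\<close>; or \<open>u @ [linv l]\<close> is reduced, so the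
  chain to \<open>y\<close> passes through \<open>act l y\<close> and supplies the label
  there.\<close>

private lemma arc_consistent_refine: "arc_consistent S'"
  unfolding arc_consistent_def
proof (intro ballI allI impI)
  fix y s and l :: letter assume y: "y \<in> D" and l: "fst l \<in> I" and s: "s \<in> S' y"
  have sS: "s \<in> S y" using s refine_sub by blast
  then obtain t where t: "t \<in> S (act l y)" "step l s t"
    using S(1) y l unfolding label_domain_def arc_consistent_def by blast
  show "\<exists>t\<in>S' (act l y). step l s t"
  proof (cases "near (act l y)")
    case True
    then obtain v u where vu: "v \<in> V" "red_word I u" "length u < M" "walk u v = act l y"
      by (auto simp: near_def)
    show ?thesis
    proof (cases "u \<noteq> [] \<and> last u = l")
      case True
      then obtain u' where u': "u = u' @ [l]" by (metis append_butlast_last_id)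
      have "act (linv l) (walk u v) = y" using vu(4) by simp
      then have "walk u' v = y" using u' by simp
      moreover have "red_word I u'" using vu(2) u' by (simp add: red_word_append)
      ultimately have "chain S u' v (\<kappa> v) s" using s vu(1) unfolding mem_refine_iff by blast
      then have "chain S u v (\<kappa> v) t" using u' t \<open>walk u' v = y\<close> by (auto simp: chain_append)
      then show ?thesis using mem_refine_near[OF vu(1-3)] vu(4) t(2) by auto
    next
      case False
      then have "red_word I (u @ [linv l])" using vu(2) l by (auto simp: red_word_append red_word_Cons)
      moreover have "walk (u @ [linv l]) v = y" using vu(4) by simp
      ultimately have "chain S (u @ [linv l]) v (\<kappa> v) s" using s vu(1) unfolding mem_refine_iff by blast
      then obtain t' where "chain S u v (\<kappa> v) t'" "step l s t'" by (auto simp: chain_append)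
      then show ?thesis using mem_refine_near[OF vu(1-3)] vu(4) by auto
    qed
  next
    case False
    then show ?thesis using refine_far t by blast
  qed
qed

lemma label_domain_refine: "label_domain (refine S V \<kappa>)"
  using S(1) refine_nonempty arc_consistent_refine refine_sub[of S V \<kappa>]
  unfolding label_domain_def by (meson order_trans)

text \<open>If both ends are near the same point of \<open>V\<close>, uniqueness of reduced words
  makes the walk shorter than \<open>2 * M\<close>. Different points of \<open>V\<close> are more
  than \<open>5 * M\<close> apart, which leaves more than \<open>3 * M\<close> between the
  ends.\<close>

private lemma near_gap:
  assumes "y \<in> D" "red_word I w" "near y" "near (walk w y)"
  shows "length w < 2 * M \<or> 3 * M < length w"
proof (rule ccontr)
  assume len: "\<not> ?thesis"
  obtain v u v' u' where vu: "v \<in> V" "red_word I u" "length u < M" "walk u v = y"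
    and vu': "v' \<in> V" "red_word I u'" "length u' < M" "walk u' v' = walk w y"
    using assms by (auto simp: near_def)
  have "fst ` set (u @ w @ winv u') \<subseteq> I" using assms vu vu' by (simp add: red_word_def image_Un set_winv)
  then obtain x where x: "red_word I x" "length x \<le> length (u @ w @ winv u')" "walk x = walk (u @ w @ winv u')"
    by (rule exists_reduced)
  have "walk x v = walk (winv u') (walk w y)" using x(3) vu(4) by simp
  also have "\<dots> = v'" by (simp flip: vu'(4))
  finally have xv: "walk x v = v'" .
  have "length x \<le> 5 * M" using x(2) vu vu' len by simp
  then have "x = []" using sparse[of v x] x(1) vu vu' xv by auto
  then have "v = v'" using xv by simp
  have "fst ` set (winv u @ u') \<subseteq> I" using vu vu' by (simp add: red_word_def image_Un set_winv)
  then obtain z where z: "red_word I z" "length z \<le> length (winv u @ u')" "walk z = walk (winv u @ u')"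
    by (rule exists_reduced)
  have "walk (winv u) y = v" by (simp flip: vu(4))
  then have "walk z y = walk w y" using z(3) vu'(4) \<open>v = v'\<close> by simp
  then have "z = w" by (rule walk_inject[OF assms(1) z(1) assms(2)])
  then show False using z(2) vu vu' len by simp
qed

text \<open>Within length \<open>4 * M\<close> there is a window of \<open>M\<close> steps that
  avoids all points near \<open>V\<close>. There the refined sets coincide with \<open>S\<close> and
  the old mixing applies; arc consistency carries the end labels into the window from both
  sides.\<close>

lemma mixing_refine: "mixing (4 * M) (refine S V \<kappa>)"
  unfolding mixing_def
proof (intro ballI allI impI, elim conjE)
  fix y w s t
  assume y: "y \<in> D" and w: "red_word I w" "4 * M \<le> length w" and s: "s \<in> S' y" and t: "t \<in> S' (walk w y)"
  have red_word_sub: "red_word I (take i w)" "red_word I (drop i w)" for i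
    using w(1) red_word_append[of I "take i w" "drop i w"] by auto
  let ?p = "\<lambda>j. walk (take j w) y"
  have gap: "j - i < 2 * M \<or> 3 * M < j - i" if "i < j" "j \<le> length w" "near (?p i)" "near (?p j)" for i j
  proof -
    let ?w = "drop i (take j w)"
    have "take i (take j w) = take i w" using that by (simp add: min_def)
    then have eq: "take j w = take i w @ ?w" using append_take_drop_id[of i "take j w"] by simp
    have "red_word I (take i w @ ?w)" using red_word_sub(1)[of j] eq by simp
    then have "red_word I ?w" by (simp add: red_word_append)
    moreover have "?p j = walk ?w (?p i)" by (subst eq) simp
    ultimately show ?thesis
      using near_gap[of "?p i" ?w] that y walk_D_red_word[OF y red_word_sub(1)] by auto
  qed
  \<comment> \<open>After a near point at position \<open>i \<le> M\<close> no other occurs at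
    distance \<open>2 * M\<close> to \<open>3 * M\<close>, and \<open>i + 3 * M\<close> still fits
    into \<open>4 * M\<close>. Without such an \<open>i\<close>, the first \<open>M\<close> steps
    serve.\<close>
  have "\<exists>a. a + M \<le> length w \<and> (\<forall>j. a \<le> j \<and> j \<le> a + M \<longrightarrow> \<not> near (?p j))"
  proof (cases "\<exists>i\<le>M. near (?p i)")
    case True
    then obtain i where i: "i \<le> M" "near (?p i)" by blast
    have "\<not> near (?p j)" if "i + 2 * M \<le> j" "j \<le> i + 2 * M + M" for j
    proof
      assume "near (?p j)"
      moreover have "M > 0" using i(2) by (auto simp: near_def)
      ultimately show False using gap[of i j] i that w(2) by auto
    qed
    then show ?thesis using i w(2) by (intro exI[of _ "i + 2 * M"]) auto
  next
    case False
    then show ?thesis using w(2) by (intro exI[of _ 0]) auto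
  qed
  then obtain a where a: "a + M \<le> length w" "\<And>j. a \<le> j \<Longrightarrow> j \<le> a + M \<Longrightarrow> \<not> near (?p j)" by blast
  define u x v where "u = take a w" and "x = take M (drop a w)" and "v = drop M (drop a w)"
  have w_eq: "w = u @ x @ v" by (simp only: u_def v_def x_def append_take_drop_id)
  have len: "length u = a" "length x = M" using a(1) by (auto simp: u_def x_def)
  have red_word: "red_word I u" "red_word I x" "red_word I v" using w(1) unfolding w_eq by (auto simp: red_word_append)
  have D: "walk u y \<in> D" "walk x (walk u y) \<in> D" using walk_D_red_word y red_word by auto
  have far: "S' (walk (take j x) (walk u y)) = S (walk (take j x) (walk u y))" if "j \<le> M" for j
    using a(2)[of "a + j"] that len by (intro refine_far) (simp add: w_eq)
  have sets: "fst ` set u \<subseteq> I" "fst ` set v \<subseteq> I" using red_word by (simp_all add: red_word_def)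
  obtain s1 where s1: "s1 \<in> S' (walk u y)" "chain S' u y s s1"
    using chain_forward[OF arc_consistent_refine y sets(1) s] by blast
  have "t \<in> S' (walk v (walk x (walk u y)))" using t by (simp add: w_eq)
  then obtain t1 where t1: "t1 \<in> S' (walk x (walk u y))" "chain S' v (walk x (walk u y)) t1 t"
    using chain_backward[OF arc_consistent_refine D(2) sets(2)] by blast
  have "chain S x (walk u y) s1 t1"
    using S(2) D(1) red_word(2) len s1(1) t1(1) refine_sub unfolding mixing_def by blast
  then have "chain S' x (walk u y) s1 t1" using chain_cong[of x S' "walk u y" S] far len by simp
  then show "chain S' w y s t" using s1(2) t1(2) by (auto simp: w_eq chain_append)
qed

end

end

text \<open>The assumption \<open>scattered\<close> provides far apart points on which all labels can be placed
  at the start, so that no piece ends up meager.\<close>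

locale baire_congruence_action =
  free_congruence_action r I L R act D
  for r I L R and act :: "letter \<Rightarrow> 'a::polish_space \<Rightarrow> 'a" and D +
  assumes continuous_act: "continuous_on UNIV (act l)"
    and finite_I: "finite I"
    and comeager_D: "comeager D"
    and scattered: "\<And>n. \<exists>h :: nat \<Rightarrow> 'a \<Rightarrow> 'a. (\<forall>k\<in>{1..r}. (\<exists>h'. homeomorphism UNIV UNIV (h k) h') \<and> h k ` D \<subseteq> D) \<and>
      (\<forall>j\<in>{1..r}. \<forall>k\<in>{1..r}. \<forall>x\<in>D. \<forall>w. red_word I w \<and> length w \<le> n \<and> fold act w (h j x) = h k x \<longrightarrow> j = k)"
begin

section \<open>Label domains with the property of Baire, and their limit\<close>

lemma homeomorphism_walk: "homeomorphism UNIV UNIV (walk w) (walk (winv w))"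
proof -
  have "continuous_on UNIV (walk w)" for w
  proof (induction w)
    case (Cons l w)
    then show ?case
      using continuous_on_compose[OF continuous_act continuous_on_subset[OF Cons subset_UNIV]]
      by simp
  qed (simp add: id_def)
  then show ?thesis by (intro homeomorphismI) auto
qed

definition baire_domain :: "('a \<Rightarrow> nat set) \<Rightarrow> bool" where
  "baire_domain S \<longleftrightarrow> label_domain S \<and> (\<exists>M. mixing M S) \<and> (\<forall>k. baire_property {y. k \<in> S y})"

lemma baire_property_chain:
  assumes "\<And>k. baire_property {y. k \<in> S y}" shows "baire_property {y. chain S w y s t}"
proof (induction w arbitrary: s)
  case Nil
  show ?case unfolding chain.simps by (rule baire_property_Collect_const)
next
  case (Cons l w)
  have "baire_property {y. \<exists>u\<in>UNIV. u \<in> S y \<and> step l s u \<and> chain S w y u t}"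
    by (intro baire_property_Collect_ex baire_property_Collect_conj assms Cons
        baire_property_Collect_const) auto
  from baire_property_Collect_homeomorphism[OF homeomorphism_walk[of "[l]"] this]
  show ?case by (simp add: Bex_def conj_assoc)
qed

lemma baire_domain_refine:
  assumes S: "baire_domain S" "mixing M S"
    and V: "V \<subseteq> D" "\<And>v. v \<in> V \<Longrightarrow> \<kappa> v \<in> S v" "\<And>k. baire_property {v \<in> V. \<kappa> v = k}"
    and sparse: "\<And>v w. v \<in> V \<Longrightarrow> red_word I w \<Longrightarrow> w \<noteq> [] \<Longrightarrow> length w \<le> 5 * M \<Longrightarrow> walk w v \<notin> V"
  shows "baire_domain (refine S V \<kappa>)"
proof -
  have LS: "label_domain S" and BS: "\<And>k. baire_property {y. k \<in> S y}"
    using S(1) by (auto simp: baire_domain_def)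
  have "baire_property {y. s \<in> refine S V \<kappa> y}" for s
  proof -
    have "baire_property {z. \<not> (\<exists>k\<in>UNIV. (z \<in> V \<and> \<kappa> z = k) \<and> \<not> chain S w z k s)}" for w
      by (intro baire_property_Collect_not baire_property_Collect_ex baire_property_Collect_conj
          baire_property_chain BS V) auto
    from baire_property_Collect_homeomorphism[OF homeomorphism_walk[of "winv w" for w] this]
    have "baire_property {z. \<not> (\<exists>k\<in>UNIV. (walk (winv w) z \<in> V \<and> \<kappa> (walk (winv w) z) = k) \<and>
       \<not> chain S w (walk (winv w) z) k s)}" for w .
    then have "baire_property {y. s \<in> S y \<and> (\<forall>w\<in>{w. red_word I w}. \<not> (\<exists>k\<in>UNIV. (walk (winv w) y \<in> V \<and> \<kappa> (walk (winv w) y) = k) \<and>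
       \<not> chain S w (walk (winv w) y) k s))}"
      by (intro baire_property_Collect_conj baire_property_Collect_all BS) auto
    then show ?thesis by (simp add: refine_def)
  qed
  then show ?thesis
    using label_domain_refine[OF LS S(2) V(1,2) sparse] mixing_refine[OF LS S(2) V(1,2) sparse]
    unfolding baire_domain_def by blast
qed

lemma baire_property_D: "baire_property D"
  using baire_property_Compl[OF baire_property_meager, of "- D"] comeager_D
  by (simp add: comeager_def)

text \<open>The values are separated at two independent points of \<open>W\<close>: this keeps a
  word from carrying one point of the neighbourhood to another.\<close>

lemma separating_neighbourhood:
  fixes x :: 'a and \<Phi> :: "(('a \<Rightarrow> 'a) \<times> ('a \<Rightarrow> 'a)) set"
  assumes "finite \<Phi>" and \<Phi>: "\<And>g h. (g, h) \<in> \<Phi> \<Longrightarrow> continuous_on UNIV g \<and> continuous_on UNIV h \<and> g x \<noteq> h x"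
  obtains W where "open W" "x \<in> W" "\<And>g h y z. (g, h) \<in> \<Phi> \<Longrightarrow> y \<in> W \<Longrightarrow> z \<in> W \<Longrightarrow> g y \<noteq> h z"
proof -
  have "\<exists>W. open W \<and> x \<in> W \<and> (\<forall>y\<in>W. \<forall>z\<in>W. fst p y \<noteq> snd p z)" if p: "p \<in> \<Phi>" for p
  proof -
    have c: "continuous_on UNIV (fst p)" "continuous_on UNIV (snd p)" and ne: "fst p x \<noteq> snd p x"
      using \<Phi>[of "fst p" "snd p"] p by auto
    obtain A B where AB: "open A" "open B" "fst p x \<in> A" "snd p x \<in> B" "A \<inter> B = {}"
      using hausdorff[OF ne] by blast
    have "open (fst p -` A)" "open (snd p -` B)"
      using AB c by (auto intro: open_vimage)
    then have "open (fst p -` A \<inter> snd p -` B)" "x \<in> fst p -` A \<inter> snd p -` B" using AB by auto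
    moreover have "fst p y \<noteq> snd p z" if "fst p y \<in> A" "snd p z \<in> B" for y z
      using that AB(5) by (metis disjoint_iff)
    ultimately show ?thesis by blast
  qed
  then obtain W where W: "\<And>p. p \<in> \<Phi> \<Longrightarrow> open (W p) \<and> x \<in> W p \<and> (\<forall>y\<in>W p. \<forall>z\<in>W p. fst p y \<noteq> snd p z)"
    by metis
  show thesis
  proof (rule that[of "\<Inter>p\<in>\<Phi>. W p"])
    show "open (\<Inter>p\<in>\<Phi>. W p)" using assms(1) W by (intro open_INT) auto
    show "x \<in> (\<Inter>p\<in>\<Phi>. W p)" using W by blast
    show "g y \<noteq> h z" if "(g, h) \<in> \<Phi>" "y \<in> (\<Inter>p\<in>\<Phi>. W p)" "z \<in> (\<Inter>p\<in>\<Phi>. W p)" for g h y z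
    proof -
      have "y \<in> W (g, h)" "z \<in> W (g, h)" using that by auto
      then show ?thesis using W[OF that(1)] by simp
    qed
  qed
qed

lemma continuous_walk: "continuous_on UNIV (walk w)"
  using homeomorphism_walk by (auto simp: homeomorphism_def)

text \<open>Only finitely many sets \<open>S y\<close> occur on \<open>D\<close>, so one of them,
  \<open>T\<close>, occurs on a nonmeager part of \<open>U\<close>, hence on almost all of an open
  set \<open>O1\<close>. Near a point of \<open>D\<close>, freeness makes a small neighbourhood
  sparse, and any label in \<open>T\<close> can be committed there.\<close>

lemma baire_domain_step:
  assumes S: "baire_domain S" and U: "open U" "U \<noteq> {}"
  obtains S' where "baire_domain S'" "\<And>y. S' y \<subseteq> S y" "\<not> meager {y \<in> U. \<exists>k. S' y = {k}}"
proof -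
  obtain M where M: "mixing M S" and LS: "label_domain S" and BS: "\<And>k. baire_property {y. k \<in> S y}"
    using S by (auto simp: baire_domain_def)
  \<comment> \<open>Equality of \<open>S y\<close> with \<open>T\<close> is spelled out label by
    label, which yields the property of Baire.\<close>
  define E where "E T = {y. (y \<in> U \<and> y \<in> D) \<and> (\<forall>k\<in>K. k \<in> S y \<longleftrightarrow> k \<in> T)}" for T
  have "baire_property {y. y \<in> U}" "baire_property {y. y \<in> D}"
    using U baire_property_D baire_property_open by simp_all
  moreover have "baire_property {y. k \<in> S y \<longleftrightarrow> k \<in> T}" for k T
    by (cases "k \<in> T") (auto intro: BS baire_property_Collect_not)
  ultimately have BE: "baire_property (E T)" for T
    unfolding E_def by (intro baire_property_Collect_conj baire_property_Collect_all) auto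
  have "U \<subseteq> (\<Union>T\<in>Pow K. E T) \<union> - D"
  proof
    fix y assume "y \<in> U"
    then have "y \<in> D \<Longrightarrow> y \<in> E (S y \<inter> K)" by (simp add: E_def)
    then show "y \<in> (\<Union>T\<in>Pow K. E T) \<union> - D" by blast
  qed
  moreover have "\<not> meager U" by (rule nonmeager_open[OF U])
  moreover have "meager (- D)" using comeager_D by (simp add: comeager_def)
  ultimately have "\<not> meager (\<Union>T\<in>Pow K. E T)" using meager_Un meager_subset by blast
  then obtain T where T: "T \<subseteq> K" "\<not> meager (E T)"
    using meager_UN[of "Pow K" E] by (auto intro: countable_finite)
  obtain O1 where O1: "open O1" "O1 \<noteq> {}" "meager (O1 - E T)"
    using nonmeager_baire_property_imp_open[OF BE T(2)] .
  have "O1 \<inter> E T \<noteq> {}"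
    using nonmeager_open[OF O1(1,2)] O1(3) by (metis Diff_triv)
  then obtain x where x: "x \<in> O1" "x \<in> E T" by blast
  have ST: "S y = T" if "y \<in> E T" for y
    using that T(1) LS by (auto simp: E_def label_domain_def)
  have xD: "x \<in> D" using x by (simp add: E_def)
  then obtain k where k: "k \<in> T" using LS ST[OF x(2)] by (auto simp: label_domain_def)
  let ?\<Phi> = "(\<lambda>w. (walk w, id)) ` {w. (red_word I w \<and> length w \<le> 5 * M) \<and> w \<noteq> []}"
  obtain W where W: "open W" "x \<in> W" "\<And>g h y z. (g, h) \<in> ?\<Phi> \<Longrightarrow> y \<in> W \<Longrightarrow> z \<in> W \<Longrightarrow> g y \<noteq> h z"
  proof (rule separating_neighbourhood[of ?\<Phi> x])
    show "finite ?\<Phi>" by (intro finite_imageI finite_subset[OF _ finite_red_words[OF finite_I, of "5 * M"]]) auto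
    show "continuous_on UNIV g \<and> continuous_on UNIV h \<and> g x \<noteq> h x" if "(g, h) \<in> ?\<Phi>" for g h
      using that continuous_walk free[OF xD] by (auto simp: continuous_on_id')
  qed blast
  define V where "V = (O1 \<inter> W) \<inter> E T"
  have Vsub: "V \<subseteq> D" "V \<subseteq> E T" "V \<subseteq> W" by (auto simp: V_def E_def)
  have "meager (O1 \<inter> W - V)" by (rule meager_subset[OF O1(3)]) (auto simp: V_def)
  moreover have "\<not> meager (O1 \<inter> W)" using O1 W x by (intro nonmeager_open) auto
  ultimately have nmV: "\<not> meager V"
    by (metis Diff_partition V_def inf_le1 meager_Un)
  have "baire_property {y. y \<in> O1 \<inter> W \<and> y \<in> E T}"
    using O1 W BE[of T] baire_property_open[of "O1 \<inter> W"]
    by (intro baire_property_Collect_conj) (simp_all del: Int_iff add: open_Int)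
  then have BV: "baire_property {v. v \<in> V}" by (simp add: V_def)
  have sparse: "walk w v \<notin> V" if "v \<in> V" "red_word I w" "w \<noteq> []" "length w \<le> 5 * M" for v w
    using W(3)[of "walk w" id v "walk w v"] that Vsub by auto
  have kS: "k \<in> S v" if "v \<in> V" for v using that Vsub ST k by blast
  let ?S' = "refine S V (\<lambda>_. k)"
  show thesis
  proof (rule that[of ?S'])
    show "baire_domain ?S'"
      by (rule baire_domain_refine[OF S M Vsub(1) kS _ sparse])
        (assumption | intro baire_property_Collect_conj BV baire_property_Collect_const)+
    show "?S' y \<subseteq> S y" for y by (rule refine_sub)
    have "V \<subseteq> {y \<in> U. \<exists>k. ?S' y = {k}}"
      using refine_eq_singleton[OF LS M Vsub(1) kS sparse] Vsub(2) by (auto simp: E_def)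
    then show "\<not> meager {y \<in> U. \<exists>k. ?S' y = {k}}" using nmV meager_subset by blast
  qed
qed

text \<open>All labels are placed at once, while each is still admissible everywhere; at a later
  stage a given label might no longer be available. Label \<open>k\<close> goes to the translate by
  \<open>h k\<close> of one small set.\<close>

lemma baire_domain_init:
  obtains S where "baire_domain S" "\<And>k. k \<in> K \<Longrightarrow> \<not> meager {y \<in> D. S y = {k}}"
proof -
  let ?M = "(2::nat) ^ r"
  obtain h :: "nat \<Rightarrow> 'a \<Rightarrow> 'a" where
    h: "\<And>k. k \<in> K \<Longrightarrow> \<exists>h'. homeomorphism UNIV UNIV (h k) h'" "\<And>k. k \<in> K \<Longrightarrow> h k ` D \<subseteq> D"
    and scat: "\<And>j k x w. j \<in> K \<Longrightarrow> k \<in> K \<Longrightarrow> x \<in> D \<Longrightarrow> red_word I w \<Longrightarrow> length w \<le> 5 * ?M \<Longrightarrow> walk w (h j x) = h k x \<Longrightarrow> j = k"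
    using scattered[of "5 * ?M"] by metis
  obtain h' where hh: "\<And>k. k \<in> K \<Longrightarrow> homeomorphism UNIV UNIV (h k) (h' k)" using h(1) by metis
  have ch: "continuous_on UNIV (h k)" if "k \<in> K" for k using hh[OF that] by (simp add: homeomorphism_def)
  have "D \<noteq> {}" using comeager_D nonmeager_open[of "UNIV :: 'a set"] by (auto simp: comeager_def)
  then obtain x where xD: "x \<in> D" by blast
  \<comment> \<open>The triples with \<open>j = k\<close> and \<open>w \<noteq> []\<close> make each
    translate sparse, by freeness; those with \<open>j \<noteq> k\<close>, including
    \<open>w = []\<close>, keep the translates disjoint and far apart, by
    \<open>scattered\<close>.\<close>
  let ?I = "{(w, j, k). (red_word I w \<and> length w \<le> 5 * ?M) \<and> j \<in> K \<and> k \<in> K \<and> (w \<noteq> [] \<or> j \<noteq> k)}"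
  let ?\<Phi> = "(\<lambda>(w, j, k). (walk w \<circ> h j, h k)) ` ?I"
  obtain W where W: "open W" "x \<in> W" "\<And>g h y z. (g, h) \<in> ?\<Phi> \<Longrightarrow> y \<in> W \<Longrightarrow> z \<in> W \<Longrightarrow> g y \<noteq> h z"
  proof (rule separating_neighbourhood[of ?\<Phi> x])
    have "finite ({w. red_word I w \<and> length w \<le> 5 * ?M} \<times> K \<times> K)"
      using finite_red_words[OF finite_I, of "5 * ?M"] by simp
    then show "finite ?\<Phi>" by (intro finite_imageI) (rule finite_subset[rotated], auto)
    show "continuous_on UNIV g \<and> continuous_on UNIV g' \<and> g x \<noteq> g' x" if "(g, g') \<in> ?\<Phi>" for g g'
    proof -
      obtain p where p: "p \<in> ?I" "(g, g') = (\<lambda>(w, j, k). (walk w \<circ> h j, h k)) p"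
        using \<open>(g, g') \<in> ?\<Phi>\<close> by (rule imageE) blast
      obtain w j k where "p = (w, j, k)" by (cases p)
      with p have *: "red_word I w" "length w \<le> 5 * ?M" "j \<in> K" "k \<in> K" "w \<noteq> [] \<or> j \<noteq> k"
        "g = walk w \<circ> h j" "g' = h k"
        by simp_all
      have "continuous_on UNIV g"
        unfolding * by (intro continuous_on_compose ch * continuous_on_subset[OF continuous_walk]) auto
      moreover have "walk w (h j x) \<noteq> h k x"
      proof
        assume eq: "walk w (h j x) = h k x"
        then have "j = k" using scat * xD by blast
        then show False using free[of "h j x" w] eq * h(2) xD by auto
      qed
      ultimately show ?thesis using * ch by simp
    qed
  qed blast
  define V where "V = (\<Union>k\<in>K. h k ` (W \<inter> D))"
  define \<kappa> where "\<kappa> v = (THE k. k \<in> K \<and> v \<in> h k ` (W \<inter> D))" for v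
  have sep: "walk w (h j y) \<noteq> h k z"
    if "red_word I w" "length w \<le> 5 * ?M" "j \<in> K" "k \<in> K" "w \<noteq> [] \<or> j \<noteq> k" "y \<in> W" "z \<in> W" for w j k y z
  proof -
    have "(walk w \<circ> h j, h k) \<in> ?\<Phi>" using that by (intro image_eqI[of _ _ "(w, j, k)"]) auto
    from W(3)[OF this that(6,7)] show ?thesis by simp
  qed
  have \<kappa>: "\<kappa> (h k y) = k" if "k \<in> K" "y \<in> W" "y \<in> D" for k y
    unfolding \<kappa>_def
  proof (rule the_equality)
    show "j = k" if "j \<in> K \<and> h k y \<in> h j ` (W \<inter> D)" for j
      using sep[of "[]" k j y] that \<open>k \<in> K\<close> \<open>y \<in> W\<close> by auto
  qed (use that in auto)
  have VD: "V \<subseteq> D" unfolding V_def using h(2) by blast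
  have eqk: "{v \<in> V. \<kappa> v = k} = (if k \<in> K then h k ` (W \<inter> D) else {})" for k
    by (auto simp: V_def \<kappa>)
  have "baire_property (h k ` (W \<inter> D))" if "k \<in> K" for k
    using baire_property_Collect_conj[of "\<lambda>y. y \<in> W" "\<lambda>y. y \<in> D"] W(1)
    by (intro baire_property_homeomorphic_image[OF hh[OF that]])
      (auto simp: Int_def baire_property_open baire_property_D)
  then have BV: "baire_property {v \<in> V. \<kappa> v = k}" for k
    unfolding eqk by (auto intro: baire_property_meager)
  have kS: "\<kappa> v \<in> K" if "v \<in> V" for v
    using that \<kappa> unfolding V_def by auto
  have sparse: "walk w v \<notin> V" if "v \<in> V" "red_word I w" "w \<noteq> []" "length w \<le> 5 * ?M" for v w
    using sep[of w] that unfolding V_def by blast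
  have BC: "baire_domain (\<lambda>_. K)"
    unfolding baire_domain_def using label_domain_const mixing_const baire_property_Collect_const by blast
  let ?S = "refine (\<lambda>_. K) V \<kappa>"
  show thesis
  proof (rule that[of ?S])
    show "baire_domain ?S" by (rule baire_domain_refine[OF BC mixing_const VD kS BV sparse])
    fix k assume k: "k \<in> K"
    have "\<not> meager (W \<inter> D)"
    proof
      assume "meager (W \<inter> D)"
      moreover have "meager (- D)" using comeager_D by (simp add: comeager_def)
      ultimately have "meager (W \<inter> D \<union> - D)" by (rule meager_Un)
      then have "meager W" by (rule meager_subset) blast
      then show False using nonmeager_open W by blast
    qed
    moreover have "h' k ` h k ` (W \<inter> D) = W \<inter> D"
      using hh[OF k] by (simp add: image_image homeomorphism_def)
    ultimately have "\<not> meager (h k ` (W \<inter> D))"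
      using meager_homeomorphic_image[OF homeomorphism_symD[OF hh[OF k]]] by metis
    moreover have "h k ` (W \<inter> D) \<subseteq> {y \<in> D. ?S y = {k}}"
    proof
      fix y assume y: "y \<in> h k ` (W \<inter> D)"
      then have "y \<in> V" using k by (auto simp: V_def)
      moreover have "\<kappa> y = k" using y \<kappa>[OF k] by auto
      ultimately show "y \<in> {y \<in> D. ?S y = {k}}"
        using refine_eq_singleton[where V = V and \<kappa> = \<kappa> and v = y, OF label_domain_const mixing_const VD]
          kS sparse VD by blast
    qed
    ultimately show "\<not> meager {y \<in> D. ?S y = {k}}" using meager_subset by blast
  qed
qed

text \<open>The stages run through a countable base and decide the label on a nonmeager part of each
  nonempty base set; a decided label never changes. Arc consistency at a stage where
  \<open>y\<close> and \<open>act l y\<close> are both decided gives the condition on their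
  labels.\<close>

theorem exists_baire_labeling:
  obtains D' c where "comeager D'" "D' \<subseteq> D" "\<And>y l. y \<in> D' \<Longrightarrow> fst l \<in> I \<Longrightarrow> act l y \<in> D'"
    "\<And>y. y \<in> D' \<Longrightarrow> c y \<in> K"
    "\<And>y l. y \<in> D' \<Longrightarrow> fst l \<in> I \<Longrightarrow> step l (c y) (c (act l y))"
    "\<And>k. k \<in> K \<Longrightarrow> baire_property {y \<in> D'. c y = k} \<and> \<not> meager {y \<in> D'. c y = k}"
proof -
  obtain S0 where S0: "baire_domain S0" "\<And>k. k \<in> K \<Longrightarrow> \<not> meager {y \<in> D. S0 y = {k}}"
    using baire_domain_init by metis
  obtain \<B> :: "'a set set" where \<B>: "countable \<B>" "topological_basis \<B>"
    using ex_countable_basis by blast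
  have "\<B> \<noteq> {}"
  proof
    assume "\<B> = {}"
    then have "(UNIV :: 'a set) = {}" using topological_basisE[OF \<B>(2) open_UNIV UNIV_I] by blast
    then show False by simp
  qed
  define u where "u = from_nat_into \<B>"
  have u: "open (u n)" for n
    using topological_basis_open[OF \<B>(2)] from_nat_into[OF \<open>\<B> \<noteq> {}\<close>] by (simp add: u_def)
  have "\<exists>f. \<forall>n::nat. (baire_domain (f n) \<and> (\<forall>y. f n y \<subseteq> S0 y)) \<and>
    ((\<forall>y. f (Suc n) y \<subseteq> f n y) \<and> (u n \<noteq> {} \<longrightarrow> \<not> meager {y \<in> u n. \<exists>k. f (Suc n) y = {k}}))"
  proof (rule dependent_nat_choice)
    show "\<exists>S. baire_domain S \<and> (\<forall>y. S y \<subseteq> S0 y)" using S0(1) by blast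
    fix S n assume S: "baire_domain S \<and> (\<forall>y. S y \<subseteq> S0 y)"
    show "\<exists>S'. (baire_domain S' \<and> (\<forall>y. S' y \<subseteq> S0 y)) \<and> (\<forall>y. S' y \<subseteq> S y) \<and>
      (u n \<noteq> {} \<longrightarrow> \<not> meager {y \<in> u n. \<exists>k. S' y = {k}})"
    proof (cases "u n = {}")
      case False
      obtain S' where "baire_domain S'" "\<And>y. S' y \<subseteq> S y" "\<not> meager {y \<in> u n. \<exists>k. S' y = {k}}"
        using baire_domain_step[OF conjunct1[OF S] u False] by blast
      moreover have "\<forall>y. S' y \<subseteq> S0 y" using calculation(2) S by blast
      ultimately show ?thesis by blast
    qed (use S in blast)
  qed
  then obtain f where f: "\<And>n. baire_domain (f n)" "\<And>n y. f n y \<subseteq> S0 y" "\<And>n y. f (Suc n) y \<subseteq> f n y"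
    "\<And>n. u n \<noteq> {} \<Longrightarrow> \<not> meager {y \<in> u n. \<exists>k. f (Suc n) y = {k}}"
    by blast
  have mono: "f m y \<subseteq> f n y" if "n \<le> m" for m n y
    using lift_Suc_antimono_le[of "\<lambda>n. f n y"] f(3) that by blast
  have fK: "f n y \<noteq> {}" "f n y \<subseteq> K" if "y \<in> D" for n y
    using f(1)[of n] that by (auto simp: baire_domain_def label_domain_def)
  have single: "f m y = {k}" if "f n y = {k}" "n \<le> m" "y \<in> D" for n m y k
    using mono[OF that(2), of y] fK(1)[OF that(3), of m] that(1) by auto
  have unique: "j = k" if "f n y = {j}" "f m y = {k}" "y \<in> D" for n m y j k
    using single[OF that(1), of "max n m"] single[OF that(2), of "max n m"] that(3) by auto
  define A where "A k = {y. y \<in> D \<and> (\<exists>n\<in>UNIV. k \<in> f n y \<and> (\<forall>j\<in>K - {k}. j \<notin> f n y))}" for k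
  have A_iff: "y \<in> A k \<longleftrightarrow> y \<in> D \<and> (\<exists>n. f n y = {k})" for y k
    using fK unfolding A_def by blast
  have "baire_property {y. k \<in> f n y}" for k n using f(1) by (auto simp: baire_domain_def)
  then have BA: "baire_property (A k)" for k
    unfolding A_def using baire_property_D
    by (intro baire_property_Collect_conj baire_property_Collect_ex baire_property_Collect_all
        baire_property_Collect_not) (auto intro: countable_finite)
  define B where "B = (\<Union>k\<in>K. A k)"
  have BB: "baire_property B" unfolding B_def by (intro baire_property_UN BA) (auto intro: countable_finite)
  have mD: "meager (- D)" using comeager_D by (simp add: comeager_def)
  \<comment> \<open>If the undecided points were nonmeager, they would fill an open set up to a
    meager set, against the stage that treats a base set inside it.\<close>
  have mB: "meager (- B)"
  proof (rule ccontr)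
    assume "\<not> meager (- B)"
    then obtain U where U: "open U" "U \<noteq> {}" "meager (U - - B)"
      using nonmeager_baire_property_imp_open[OF baire_property_Compl[OF BB]] by blast
    then obtain x where "x \<in> U" by blast
    then obtain b where b: "b \<in> \<B>" "x \<in> b" "b \<subseteq> U" using topological_basisE[OF \<B>(2) U(1)] by metis
    then obtain n where n: "u n = b" unfolding u_def using from_nat_into_surj[OF \<B>(1)] by blast
    have "{y \<in> u n. \<exists>k. f (Suc n) y = {k}} \<subseteq> (U - - B) \<union> - D"
    proof
      fix y assume y: "y \<in> {y \<in> u n. \<exists>k. f (Suc n) y = {k}}"
      then obtain k where k: "f (Suc n) y = {k}" by blast
      then have "y \<in> D \<Longrightarrow> k \<in> K \<and> y \<in> A k" using fK(2)[of y "Suc n"] A_iff by auto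
      then show "y \<in> (U - - B) \<union> - D" using y b n by (auto simp: B_def)
    qed
    then have "meager {y \<in> u n. \<exists>k. f (Suc n) y = {k}}"
      using meager_subset[OF meager_Un[OF U(3) mD]] by blast
    then show False using f(4)[of n] n b by blast
  qed
  \<comment> \<open>The largest subset of decided points of \<open>D\<close> that is closed under
    the letters from \<open>I\<close>. As there are countably many words, only a meager set is
    lost.\<close>
  define D' where "D' = {y \<in> D. \<forall>w. fst ` set w \<subseteq> I \<longrightarrow> walk w y \<in> B}"
  define c where "c y = (THE k. \<exists>n. f n y = {k})" for y
  have c_eq: "c y = k" if "y \<in> D" "f n y = {k}" for y k n
    unfolding c_def using that unique by (intro the_equality) blast+
  have D'B: "y \<in> B" if "y \<in> D'" for y
    using that unfolding D'_def by (metis (mono_tags, lifting) empty_set fold_simps(1) image_empty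
        empty_subsetI mem_Collect_eq)
  have D'_inv: "act l y \<in> D'" if "y \<in> D'" "fst l \<in> I" for y l
    unfolding D'_def
  proof (intro CollectI conjI allI impI)
    show "act l y \<in> D" using that act_D by (simp add: D'_def)
    fix w :: "letter list" assume "fst ` set w \<subseteq> I"
    then have "fst ` set (l # w) \<subseteq> I" using that(2) by simp
    then have "walk (l # w) y \<in> B" using that(1) unfolding D'_def by blast
    then show "walk w (act l y) \<in> B" by simp
  qed
  have c_ev: "\<exists>n. \<forall>m\<ge>n. f m y = {c y}" if "y \<in> D'" for y
  proof -
    obtain k n where "k \<in> K" "y \<in> D" "f n y = {k}"
      using D'B[OF \<open>y \<in> D'\<close>] A_iff by (auto simp: B_def)
    then show ?thesis using c_eq single by blast
  qed
  have D'D: "D' \<subseteq> D" by (auto simp: D'_def)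
  have "- D' \<subseteq> - D \<union> (\<Union>w. walk (winv w) ` (- B))"
  proof
    fix y assume "y \<in> - D'"
    then consider "y \<notin> D" | w where "walk w y \<in> - B" unfolding D'_def by blast
    then show "y \<in> - D \<union> (\<Union>w. walk (winv w) ` (- B))"
    proof cases
      case (2 w)
      have "y = walk (winv w) (walk w y)" by simp
      then show ?thesis using 2 by blast
    qed simp
  qed
  moreover have "meager (\<Union>w. walk (winv w) ` (- B))"
    by (intro meager_UN meager_homeomorphic_image[OF homeomorphism_walk] mB) auto
  ultimately have cD': "comeager D'"
    unfolding comeager_def using meager_subset meager_Un[OF mD] by blast
  show thesis
  proof (rule that[of D' c])
    show cK: "c y \<in> K" if "y \<in> D'" for y
    proof -
      obtain n where "f n y = {c y}" using c_ev[OF \<open>y \<in> D'\<close>] by blast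
      then show ?thesis using fK(2)[of y n] that D'D by auto
    qed
    show "step l (c y) (c (act l y))" if y: "y \<in> D'" and l: "fst l \<in> I" for y l
    proof -
      obtain n where n: "\<And>m. m \<ge> n \<Longrightarrow> f m y = {c y}" using c_ev[OF y] by blast
      obtain n' where n': "\<And>m. m \<ge> n' \<Longrightarrow> f m (act l y) = {c (act l y)}"
        using c_ev[OF D'_inv[OF y l]] by blast
      have "arc_consistent (f (max n n'))" using f(1) by (auto simp: baire_domain_def label_domain_def)
      moreover have "c y \<in> f (max n n') y" using n by simp
      ultimately obtain t where "t \<in> f (max n n') (act l y)" "step l (c y) t"
        using arc_consistentE[of "f (max n n')" y l "c y"] y l D'D by blast
      then show ?thesis using n'[of "max n n'"] by simp
    qed
    fix k assume k: "k \<in> K"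
    have eq: "{y \<in> D'. c y = k} = A k - - D'"
    proof -
      have "c y = k \<longleftrightarrow> y \<in> A k" if "y \<in> D'" for y
        using c_ev[OF that] c_eq that D'D A_iff[of y k] by (metis order_refl subsetD)
      then show ?thesis by blast
    qed
    have "baire_property {y. y \<in> A k \<and> \<not> y \<in> - D'}"
      using BA[of k] baire_property_meager[of "- D'"] cD'
      by (intro baire_property_Collect_conj baire_property_Collect_not) (simp_all add: comeager_def del: ComplI Compl_iff)
    moreover have "\<not> meager (A k - - D')"
    proof
      assume "meager (A k - - D')"
      then have "meager (A k - - D' \<union> - D')" using cD' by (intro meager_Un) (simp_all add: comeager_def)
      moreover have "{y \<in> D. S0 y = {k}} \<subseteq> A k"
        using f(2)[of 0] fK(1)[of _ 0] by (auto simp: A_iff) (metis subset_singletonD)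
      ultimately show False using S0(2)[OF k] meager_subset[of "A k - - D' \<union> - D'"] by blast
    qed
    ultimately show "baire_property {y \<in> D'. c y = k} \<and> \<not> meager {y \<in> D'. c y = k}"
      unfolding eq by (simp add: set_diff_eq)
  qed (use D'_inv cD' D'D in auto)
qed

end

section \<open>Labels on locally commutative orbits\<close>

locale commuting_congruence_action = congruence_action +
  assumes free_walk: "red_word I w \<Longrightarrow> w \<noteq> [] \<Longrightarrow> \<exists>y. walk w y \<noteq> y"
    and locally_commutative: "fst ` set u \<subseteq> I \<Longrightarrow> fst ` set v \<subseteq> I \<Longrightarrow> walk u x = x \<Longrightarrow> walk v x = x \<Longrightarrow>
      walk u (walk v y) = walk v (walk u y)"
begin

text \<open>A point adjacent to a walk-closed set is joined to it by a single edge, so a labeling of the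
  set always extends to that point.\<close>

definition walk_closed :: "'a set \<Rightarrow> bool" where
  "walk_closed Y \<longleftrightarrow> (\<forall>y\<in>Y. \<forall>l w. red_word I (l # w) \<longrightarrow> walk (l # w) y \<in> Y \<longrightarrow> act l y \<in> Y)"

text \<open>A relation instead of a function, so that Zorn's lemma works with inclusion and unions
  of chains.\<close>

definition partial_labeling :: "('a \<times> nat) set \<Rightarrow> bool" where
  "partial_labeling Q \<longleftrightarrow> single_valued Q \<and> Range Q \<subseteq> K \<and> walk_closed (Domain Q) \<and>
     (\<forall>y a l b. (y, a) \<in> Q \<longrightarrow> fst l \<in> I \<longrightarrow> (act l y, b) \<in> Q \<longrightarrow> step l a b)"

lemma walk_closedD:
  "walk_closed Y \<Longrightarrow> y \<in> Y \<Longrightarrow> red_word I (l # w) \<Longrightarrow> walk w (act l y) \<in> Y \<Longrightarrow> act l y \<in> Y"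
  unfolding walk_closed_def by (metis fold_simps(2))

lemma act_inject [simp]: "act l y = act l z \<longleftrightarrow> y = z"
  by (metis act_linv)

text \<open>A reduced walk that touches the new point only at an end can be turned into one between
  points of \<open>Y\<close>: at the start by prepending \<open>l\<close>, at the end by deleting a
  final \<open>l\<close> or appending \<open>linv l\<close>.\<close>

lemma walk_closed_insert:
  assumes Y: "walk_closed Y" "y \<in> Y" and l: "fst l \<in> I" and z: "act l y \<notin> Y"
  shows "walk_closed (insert (act l y) Y)"
  unfolding walk_closed_def
proof (intro ballI allI impI)
  let ?z = "act l y"
  let ?Y = "insert ?z Y"
  fix p k w
  assume p: "p \<in> ?Y" and w: "red_word I (k # w)" and e: "walk (k # w) p \<in> ?Y"
  have main: "act k p \<in> ?Y" if p: "p \<in> ?Y" and w: "red_word I (k # w)" and e: "walk (k # w) p \<in> Y" for w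
  proof (cases "p \<in> Y")
    case True
    then show ?thesis using walk_closedD[OF Y(1) True w] e by simp
  next
    case False
    then have pz: "p = ?z" using p by simp
    show ?thesis
    proof (cases "k = linv l")
      case False
      then have "red_word I (l # k # w)" using w l by (simp add: red_word_Cons)
      then show ?thesis using walk_closedD[OF Y(1,2), of l "k # w"] e z pz by simp
    qed (use Y(2) pz in simp)
  qed
  show "act k p \<in> ?Y"
  proof (cases "walk (k # w) p \<in> Y")
    case True
    then show ?thesis using main p w by blast
  next
    case False
    then have e': "walk (k # w) p = ?z" using e by simp
    show ?thesis
    proof (cases "last (k # w) = l")
      case True
      show ?thesis
      proof (cases "w = []")
        case True
        then show ?thesis using e' by simp
      next
        case False
        then obtain w' where w': "w = w' @ [l]" using True by (metis append_butlast_last_id last_ConsR)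
        then have "red_word I (k # w')" using w by (metis append_Cons red_word_append)
        moreover have "walk (k # w') p = y" using e' w' by simp
        ultimately show ?thesis using main p Y(2) by blast
      qed
    next
      case False
      then have "red_word I ((k # w) @ [linv l])" using w l by (subst red_word_append) (simp add: red_word_Cons)
      moreover have "walk ((k # w) @ [linv l]) p = act (linv l) (walk (k # w) p)" by simp
      ultimately show ?thesis using main[of "w @ [linv l]"] p Y(2) e' by simp
    qed
  qed
qed

text \<open>Another edge from the new point into \<open>Y\<close> would extend \<open>l\<close> to a
  reduced walk from \<open>Y\<close> back to \<open>Y\<close>, and a loop \<open>k\<close> at the
  new point would do so with \<open>[l, k, linv l]\<close>; either way the new point would already
  lie in \<open>Y\<close>.\<close>

lemma edge_to_new_point:
  assumes Y: "walk_closed Y" "y \<in> Y" and l: "fst l \<in> I" and z: "act l y \<notin> Y"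
    and k: "fst k \<in> I" "act k (act l y) \<in> insert (act l y) Y"
  shows "k = linv l"
proof (rule ccontr)
  assume k': "k \<noteq> linv l"
  show False
  proof (cases "act k (act l y) \<in> Y")
    case True
    then show False using walk_closedD[OF Y, of l "[k]"] k' l k z by (simp add: red_word_Cons)
  next
    case False
    then have eq: "act k (act l y) = act l y" using k by simp
    then have "act (linv l) (act k (act l y)) = y" by simp
    moreover have "k \<noteq> l" using eq Y(2) z by auto
    ultimately show False
      using walk_closedD[OF Y, of l "[k, linv l]"] k' l k(1) z Y(2) by (simp add: red_word_Cons)
  qed
qed

lemma partial_labeling_insert:
  assumes Q: "partial_labeling Q" "(y, a) \<in> Q" and l: "fst l \<in> I" and z: "act l y \<notin> Domain Q"
  obtains t where "partial_labeling (insert (act l y, t) Q)"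
proof -
  have sv: "single_valued Q" and QK: "Range Q \<subseteq> K" and cl: "walk_closed (Domain Q)" and yD: "y \<in> Domain Q"
    and st: "\<And>y a l b. (y, a) \<in> Q \<Longrightarrow> fst l \<in> I \<Longrightarrow> (act l y, b) \<in> Q \<Longrightarrow> step l a b"
    using Q by (auto simp: partial_labeling_def)
  obtain t where t: "t \<in> K" "step l a t" using step_total[OF l, of a] QK Q(2) by (metis Range.intros subsetD)
  let ?z = "act l y" and ?Q = "insert (act l y, t) Q"
  note edge = edge_to_new_point[OF cl yD l z]
  have "step k b c" if bc: "(p, b) \<in> ?Q" "(act k p, c) \<in> ?Q" and k: "fst k \<in> I" for p b k c
  proof -
    consider (old) "(p, b) \<in> Q" "(act k p, c) \<in> Q" | (out) "p = ?z" "b = t"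
      | (into) "(p, b) \<in> Q" "act k p = ?z" "c = t"
      using bc by blast
    then show ?thesis
    proof cases
      case old
      then show ?thesis using st k by blast
    next
      case out
      then have "k = linv l" using edge[OF k] bc by auto
      moreover from this have "(y, c) \<in> Q" using bc(2) out yD z by auto
      then have "c = a" using sv Q(2) by (metis single_valuedD)
      ultimately show ?thesis using out t by simp
    next
      case into
      have pk: "p = act (linv k) ?z" using into(2) act_linv by metis
      then have "linv k = linv l" using edge[of "linv k"] k into(1) by auto
      then have "k = l" by simp
      then have "p = y" using into(2) by simp
      then have "b = a" using into(1) sv Q(2) by (metis single_valuedD)
      then show ?thesis using \<open>k = l\<close> into t by simp
    qed
  qed
  moreover have "single_valued ?Q"
    using sv z by (auto simp: single_valued_def)
  moreover have "walk_closed (Domain ?Q)" using walk_closed_insert[OF cl yD l z] by simp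
  ultimately have "partial_labeling ?Q" using QK t(1) unfolding partial_labeling_def by auto
  then show thesis by (rule that)
qed

text \<open>By local commutativity \<open>u\<close> and \<open>v\<close> commute everywhere, yet
  \<open>winv (u @ v) @ (v @ u)\<close> is a nonempty reduced word and so moves some point.\<close>

lemma not_both_fixed:
  assumes "red_word I (u @ v)" "red_word I (v @ u)" "u \<noteq> []" "v \<noteq> []" "hd u \<noteq> hd v" "walk u x = x" "walk v x = x"
  shows False
proof -
  have "red_word I (winv (u @ v) @ (v @ u))"
    by (rule red_word_winv_append) (use assms in auto)
  then obtain y where y: "walk (winv (u @ v) @ (v @ u)) y \<noteq> y" using free_walk assms(3) by blast
  have "fst ` set u \<subseteq> I" "fst ` set v \<subseteq> I" using assms(1) by (auto simp: red_word_def)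
  then have comm: "walk (v @ u) y = walk (u @ v) y" for y
    using locally_commutative[of u v x] assms(6,7) by simp
  have "walk (winv (u @ v) @ (v @ u)) y = walk (v @ u) (walk (winv (u @ v)) y)"
    by (simp only: fold_append o_apply)
  also have "\<dots> = walk (u @ v) (walk (winv (u @ v)) y)" by (rule comm)
  also have "\<dots> = y" by (rule walk_winv')
  finally show False using y by blast
qed

text \<open>A shortest closed reduced walk in an orbit, continued periodically: \<open>e j\<close> leads from \<open>p j\<close> to
  \<open>p (Suc j)\<close>. By local commutativity the cycle cannot be left and re-entered.\<close>

context
  fixes e :: "nat \<Rightarrow> letter" and p :: "nat \<Rightarrow> 'a" and n :: nat
  assumes n: "n > 0" and eI: "\<And>j. fst (e j) \<in> I"
    and e_red: "\<And>j. e (Suc j) \<noteq> linv (e j)" and e_per: "\<And>j. e (j + n) = e j"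
    and p_Suc: "\<And>j. p (Suc j) = act (e j) (p j)" and p_per: "\<And>j. p (j + n) = p j"
    and p_eq: "\<And>i j. p i = p j \<Longrightarrow> i mod n = j mod n"
begin

private lemma e_mod: "e j = e (j mod n)" and p_mod: "p j = p (j mod n)"
proof -
  have "e (i + k * n) = e i \<and> p (i + k * n) = p i" for i k
  proof (induction k)
    case (Suc k)
    have "i + Suc k * n = (i + k * n) + n" by simp
    then show ?case using Suc by (simp only: e_per p_per)
  qed simp
  from this[of "j mod n" "j div n"] show "e j = e (j mod n)" "p j = p (j mod n)" by simp_all
qed

private lemma mod_Suc_inject:
  assumes "Suc i mod n = Suc j mod n" shows "i mod n = j mod n"
proof -
  have "(Suc i + (n - 1)) mod n = (Suc j + (n - 1)) mod n" using assms by (rule mod_add_cong) simp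
  then show ?thesis using n by simp
qed

private lemma walk_segment: "walk (map e [i..<i + k]) (p i) = p (i + k)"
  by (induction k) (simp_all add: p_Suc)

private lemma red_word_segment: "red_word I (map e [i..<k])"
  using e_red eI by (auto simp: red_word_conv_nth)

text \<open>Here \<open>w\<close> leaves the cycle at \<open>p j\<close> along neither of its two
  edges and meets it again at \<open>p k\<close>. If the last letter of \<open>w\<close> runs
  backwards along \<open>e k\<close>, it is dropped and induction applies. Otherwise
  \<open>w\<close>, continued along the cycle to \<open>p j\<close>, and the cycle itself contradict
  \<open>not_both_fixed\<close>. The index \<open>j + n - 1\<close> is the predecessor of
  \<open>j\<close> modulo \<open>n\<close>, also for \<open>j = 0\<close>.\<close>

private lemma no_return:
  assumes "red_word I w" "w \<noteq> []" "walk w (p j) = p k" "hd w \<noteq> e j" "hd w \<noteq> linv (e (j + n - 1))"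
  shows False
  using assms
proof (induction "length w" arbitrary: w k rule: less_induct)
  case less
  show False
  proof (cases "last w = linv (e k)")
    case True
    define w' where "w' = butlast w"
    have w: "w = w' @ [linv (e k)]" using True less.prems(2) by (simp add: w'_def append_butlast_last_id flip: True)
    have "walk w' (p j) = act (e k) (p k)" using less.prems(3) unfolding w
      by (metis act_linv' fold_append fold_simps o_apply)
    then have w'p: "walk w' (p j) = p (Suc k)" by (simp add: p_Suc)
    show False
    proof (cases "w' = []")
      case True
      then have "p j = p (Suc k)" using w'p by simp
      then have "j mod n = Suc k mod n" by (rule p_eq)
      then have "Suc (j + n - 1) mod n = Suc k mod n" using n by simp
      then have "(j + n - 1) mod n = k mod n"
        by (rule mod_Suc_inject)
      then have "e (j + n - 1) = e k" by (metis e_mod)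
      then show False using less.prems(5) w True by simp
    next
      case False
      have "red_word I w'" using less.prems(1) w by (simp add: red_word_append)
      moreover have "hd w = hd w'" using w False by simp
      ultimately show False using less.hyps[of w' "Suc k"] w w'p False less.prems(4,5) by simp
    qed
  next
    case False
    \<comment> \<open>An index congruent to \<open>j\<close> modulo \<open>n\<close> and larger than
      \<open>k\<close>, so the way home is a nonempty forward segment.\<close>
    define q where "q = j + n * (k + 1)"
    have "k + 1 \<le> n * (k + 1)" using mult_le_mono1[of 1 n "k + 1"] n by simp
    then have q: "k < q" unfolding q_def by linarith
    have eq_q: "p q = p j" "e q = e j" using p_mod[of q] p_mod[of j] e_mod[of q] e_mod[of j] by (simp_all add: q_def)
    have eq_q1: "e (q - 1) = e (j + n - 1)"
    proof -
      have "q - 1 = (j + n - 1) + n * k" using n by (simp add: q_def add_mult_distrib2)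
      then show ?thesis using e_mod[of "q - 1"] e_mod[of "j + n - 1"] by simp
    qed
    let ?s = "map e [k..<q]" and ?u = "map e [j..<j + n]"
    have s: "?s \<noteq> []" "hd ?s = e k" "last ?s = e (q - 1)" using q by (simp_all add: hd_map last_map)
    have u: "?u \<noteq> []" "hd ?u = e j" "last ?u = e (j + n - 1)" using n by (simp_all add: hd_map last_map)
    let ?v = "w @ ?s"
    have rv: "red_word I ?v" using less.prems(1) red_word_segment False s by (auto simp: red_word_append)
    show False
    proof (rule not_both_fixed[of ?u ?v "p j"])
      show "red_word I (?u @ ?v)"
        using rv red_word_segment u less.prems(2,5) by (subst red_word_append) auto
      have "e j \<noteq> linv (e (q - 1))" using e_red[of "q - 1"] q eq_q by auto
      then show "red_word I (?v @ ?u)"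
        using rv red_word_segment u s by (subst red_word_append) auto
      show "walk ?u (p j) = p j" using walk_segment[of j n] p_per by simp
      show "walk ?v (p j) = p j" using walk_segment[of k "q - k"] q less.prems(3) eq_q by simp
    qed (use u less.prems in auto)
  qed
qed

lemma walk_closed_cycle: "walk_closed (range p)"
  unfolding walk_closed_def
proof (intro ballI allI impI)
  fix y l w assume y: "y \<in> range p" and w: "red_word I (l # w)" and e: "walk (l # w) y \<in> range p"
  then obtain j k where jk: "y = p j" "walk (l # w) (p j) = p k" by auto
  have "l = e j \<or> l = linv (e (j + n - 1))" using no_return[OF w _ jk(2)] by auto
  then show "act l y \<in> range p"
  proof
    assume "l = linv (e (j + n - 1))"
    moreover have "y = act (e (j + n - 1)) (p (j + n - 1))"
      using p_Suc[of "j + n - 1"] n p_per[of j] jk(1) by simp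
    ultimately show ?thesis by simp
  qed (use jk(1) p_Suc in \<open>metis rangeI\<close>)
qed

text \<open>\<open>exists_label_cycle\<close> gives a label that can return to itself around the
  cycle. No further condition arises, since by \<open>no_return\<close> a single letter joins points
  of the cycle only along its own edges.\<close>

lemma partial_labeling_cycle:
  obtains Q where "partial_labeling Q" "Domain Q = range p"
proof -
  let ?u = "map e [0..<n]"
  have uI: "fst ` set ?u \<subseteq> I" using eI by auto
  have une: "?u \<noteq> []" using n by simp
  obtain s where s: "s \<in> K" "s \<in> reach ?u {s}" using exists_label_cycle[OF uI une] by blast
  have "\<exists>\<sigma>. \<sigma> 0 = s \<and> \<sigma> (m::nat) = t \<and> (\<forall>j\<le>m. \<sigma> j \<in> K) \<and> (\<forall>j<m. step (e j) (\<sigma> j) (\<sigma> (Suc j)))"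
    if "t \<in> reach (map e [0..<m]) {s}" for m t
    using that
  proof (induction m arbitrary: t)
    case 0
    then show ?case using s(1) by (intro exI[of _ "\<lambda>_. s"]) auto
  next
    case (Suc m)
    then obtain t' where t': "t' \<in> reach (map e [0..<m]) {s}" "step (e m) t' t" "t \<in> K"
      by (auto simp: img_def)
    from Suc.IH[OF this(1)] obtain \<sigma> where \<sigma>: "\<sigma> 0 = s" "\<sigma> m = t'" "\<forall>j\<le>m. \<sigma> j \<in> K"
      "\<forall>j<m. step (e j) (\<sigma> j) (\<sigma> (Suc j))" by blast
    show ?case
      using \<sigma> t' by (intro exI[of _ "\<sigma>(Suc m := t)"]) (auto simp: less_Suc_eq le_Suc_eq)
  qed
  from this[OF s(2)] obtain \<sigma> where \<sigma>: "\<sigma> 0 = s" "\<sigma> n = s" "\<And>j. j \<le> n \<Longrightarrow> \<sigma> j \<in> K"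
    "\<And>j. j < n \<Longrightarrow> step (e j) (\<sigma> j) (\<sigma> (Suc j))" by blast
  define Q where "Q = (\<lambda>j. (p j, \<sigma> (j mod n))) ` UNIV"
  have dom: "Domain Q = range p" by (auto simp: Q_def)
  have stp: "step (e j) (\<sigma> (j mod n)) (\<sigma> (Suc j mod n))" for j
  proof -
    have "\<sigma> (Suc (j mod n)) = \<sigma> (Suc j mod n)"
      using \<sigma>(1,2) by (simp add: mod_Suc)
    then show ?thesis using \<sigma>(4)[of "j mod n"] n e_mod[of j] by simp
  qed
  have "step l (\<sigma> (j mod n)) (\<sigma> (k mod n))" if l: "fst l \<in> I" and eq: "act l (p j) = p k" for l j k
  proof -
    have "l = e j \<or> l = linv (e (j + n - 1))"
      using no_return[of "[l]" j k] l eq by (auto simp: red_word_Cons)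
    then show ?thesis
    proof
      assume le: "l = e j"
      then have "p k = p (Suc j)" using eq p_Suc by simp
      then show ?thesis using stp[of j] p_eq[of k "Suc j"] le by simp
    next
      assume le: "l = linv (e (j + n - 1))"
      define i where "i = j + n - 1"
      have i: "Suc i = j + n" using n by (simp add: i_def)
      have "p j = act (e i) (p i)" using p_Suc[of i] i p_per by simp
      then have "p k = p i" using eq le by (simp add: i_def)
      then have "k mod n = i mod n" by (rule p_eq)
      moreover have "Suc i mod n = j mod n" by (simp add: i)
      ultimately show ?thesis using stp[of i] le by (simp add: i_def)
    qed
  qed
  moreover have "single_valued Q" by (auto simp: single_valued_def Q_def dest: p_eq)
  moreover have "Range Q \<subseteq> K"
  proof -
    have "\<sigma> (j mod n) \<in> K" for j using \<sigma>(3) n by (meson less_imp_le_nat mod_less_divisor)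
    then show ?thesis unfolding Q_def by blast
  qed
  ultimately have "partial_labeling Q"
    unfolding partial_labeling_def dom using walk_closed_cycle by (auto simp: Q_def)
  then show thesis using dom that by blast
qed

end

text \<open>If no reduced walk in the orbit closes up, one labeled point is a start. Otherwise the
  closed walk is chosen shortest over all base points in the orbit, which makes it cyclically
  reduced with distinct vertices.\<close>

lemma partial_labeling_in_orbit:
  obtains Q where "partial_labeling Q" "Q \<noteq> {}" "\<And>y. y \<in> Domain Q \<Longrightarrow> \<exists>w. fst ` set w \<subseteq> I \<and> y = walk w x"
proof (cases "\<exists>w u. fst ` set w \<subseteq> I \<and> red_word I u \<and> u \<noteq> [] \<and> walk u (walk w x) = walk w x")
  case False
  have nofix: "walk u x \<noteq> x" if "red_word I u" "u \<noteq> []" for u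
    using False that by (metis empty_set fold_simps(1) image_empty empty_subsetI)
  have "K \<noteq> {}" using r_pos by simp
  then obtain s where s: "s \<in> K" by blast
  have "walk_closed {x}"
    unfolding walk_closed_def using nofix[of "_ # _"] by (auto simp del: fold_simps)
  moreover have "act l x \<noteq> x" if "fst l \<in> I" for l using nofix[of "[l]"] that by (simp add: red_word_Cons)
  ultimately have "partial_labeling {(x, s)}"
    using s by (auto simp: partial_labeling_def single_valued_def)
  then show thesis
    by (rule that) (auto intro!: exI[of _ "[]"])
next
  case True
  define P where "P w u \<longleftrightarrow> fst ` set w \<subseteq> I \<and> red_word I u \<and> u \<noteq> [] \<and> walk u (walk w x) = walk w x" for w u
  obtain w u where wu: "P w u" and min: "\<And>w' u'. P w' u' \<Longrightarrow> length u \<le> length u'"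
  proof -
    have "\<exists>m. \<exists>w u. P w u \<and> length u = m" using True unfolding P_def by blast
    then obtain m where "\<exists>w u. P w u \<and> length u = m" "\<And>k. k < m \<Longrightarrow> \<not> (\<exists>w u. P w u \<and> length u = k)"
      using exists_least_iff[of "\<lambda>m. \<exists>w u. P w u \<and> length u = m"] by blast
    then show thesis using that by (metis not_le_imp_less)
  qed
  define n where "n = length u"
  define y where "y = walk w x"
  have w: "fst ` set w \<subseteq> I" and u: "red_word I u" "u \<noteq> []" "walk u y = y" using wu by (auto simp: P_def y_def)
  have n: "n > 0" using u by (simp add: n_def)
  have min': "n \<le> length u'" if "red_word I u'" "u' \<noteq> []" "walk u' (walk v y) = walk v y" "fst ` set v \<subseteq> I" for u' v
    using min[of "w @ v" u'] that w by (simp add: P_def y_def n_def image_Un)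
  define e where "e j = u ! (j mod n)" for j
  define p where "p j = walk (take (j mod n) u) y" for j
  have uI: "fst (u ! j) \<in> I" if "j < n" for j using u(1) that by (simp add: red_word_conv_nth n_def)
  have tI: "fst ` set (take j u) \<subseteq> I" for j using u(1) set_take_subset[of j u] by (auto simp: red_word_def)
  \<comment> \<open>Otherwise \<open>u\<close> has the form \<open>l # u2 @ [linv l]\<close>, and
    \<open>u2\<close> is a shorter closed walk at \<open>act l y\<close>.\<close>
  have cyc: "hd u \<noteq> linv (last u)"
  proof
    assume hl: "hd u = linv (last u)"
    obtain l u1 where lu: "u = l # u1" using u(2) by (cases u) auto
    have "u1 \<noteq> []"
    proof
      assume "u1 = []"
      then show False using hl lu by simp
    qed
    moreover have "last u = linv l" using hl lu by (metis linv_linv list.sel(1))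
    ultimately obtain u2 where u2: "u1 = u2 @ [linv l]"
      using lu by (metis append_butlast_last_id last_ConsR)
    have ru: "red_word I (l # u2 @ [linv l])" using u(1) by (simp only: lu u2)
    have "u2 \<noteq> []"
    proof
      assume "u2 = []"
      then show False using ru by (simp add: red_word_Cons)
    qed
    moreover have "red_word I u2" using ru by (simp add: red_word_Cons red_word_append)
    moreover have "walk u2 (walk [l] y) = walk [l] y"
    proof -
      have "act (linv l) (walk u2 (act l y)) = y" using u(3) by (simp add: lu u2)
      then have "act l (act (linv l) (walk u2 (act l y))) = act l y" by simp
      then show ?thesis by simp
    qed
    moreover have "fst ` set [l] \<subseteq> I" using ru by (simp add: red_word_Cons)
    ultimately have "n \<le> length u2" by (intro min'[of u2 "[l]"])
    then show False using lu u2 by (simp add: n_def)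
  qed
  \<comment> \<open>A repeated vertex would cut off a shorter closed walk.\<close>
  have nodup: False if ij: "i < j" "j < n" "walk (take i u) y = walk (take j u) y" for i j
  proof -
    let ?u = "drop i (take j u)"
    have "take i (take j u) = take i u" using ij by (simp add: min_def)
    then have eq: "take j u = take i u @ ?u" using append_take_drop_id[of i "take j u"] by simp
    have "red_word I (take j u)" using u(1) by (metis append_take_drop_id red_word_append)
    then have "red_word I ?u" by (metis eq red_word_append)
    moreover have "length ?u = j - i" using ij by (simp add: n_def)
    moreover have "walk ?u (walk (take i u) y) = walk (take i u) y"
      using arg_cong[OF eq, of "\<lambda>w. walk w y"] ij(3) by simp
    moreover have "?u \<noteq> []" using \<open>length ?u = j - i\<close> ij by (metis length_0_conv zero_less_diff less_irrefl)
    ultimately have "n \<le> j - i" using min'[of ?u "take i u"] tI by simp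
    then show False using ij by simp
  qed
  obtain Q where Q: "partial_labeling Q" "Domain Q = range p"
  proof (rule partial_labeling_cycle[of n e p])
    show "n > 0" by (rule n)
    show "fst (e j) \<in> I" for j using uI n by (simp add: e_def)
    show "e (j + n) = e j" "p (j + n) = p j" for j by (simp_all add: e_def p_def)
    show "e (Suc j) \<noteq> linv (e j)" for j
    proof (cases "Suc (j mod n) = n")
      case True
      then have "e (Suc j) = hd u" "e j = last u"
        using u(2) by (simp_all add: e_def mod_Suc hd_conv_nth last_conv_nth n_def[symmetric]) (metis diff_Suc_1)
      then show ?thesis using cyc by simp
    next
      case False
      then have "Suc j mod n = Suc (j mod n)" "Suc (j mod n) < n"
        using mod_less_divisor[OF n, of j] by (simp_all add: mod_Suc)
      then show ?thesis using u(1) by (simp add: e_def red_word_conv_nth n_def)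
    qed
    show "p (Suc j) = act (e j) (p j)" for j
    proof -
      have "act (e j) (p j) = walk (take (Suc (j mod n)) u) y"
        using n by (simp add: e_def p_def n_def take_Suc_conv_app_nth)
      also have "\<dots> = p (Suc j)"
        using u(3) by (auto simp: p_def mod_Suc n_def)
      finally show ?thesis by simp
    qed
    show "i mod n = j mod n" if "p i = p j" for i j
      using nodup[of "i mod n" "j mod n"] nodup[of "j mod n" "i mod n"] that n
      by (metis linorder_neqE_nat mod_less_divisor p_def)
  qed
  show thesis
  proof (rule that[OF Q(1)])
    show "Q \<noteq> {}" using Q(2) by auto
    show "\<exists>w. fst ` set w \<subseteq> I \<and> z = walk w x" if z: "z \<in> Domain Q" for z
    proof -
      obtain j where "z = p j" using Q(2) z by auto
      then show ?thesis
        using w tI[of "j mod n"] by (intro exI[of _ "w @ take (j mod n) u"]) (simp add: p_def y_def image_Un)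
    qed
  qed
qed

text \<open>\<open>Domain Q\<close> is invariant, so no edge joins it to
  \<open>Domain Q'\<close>.\<close>

lemma partial_labeling_Un:
  assumes Q: "partial_labeling Q" and Q': "partial_labeling Q'"
    and inv: "\<And>y l. fst l \<in> I \<Longrightarrow> act l y \<in> Domain Q \<longleftrightarrow> y \<in> Domain Q" and dj: "Domain Q \<inter> Domain Q' = {}"
  shows "partial_labeling (Q \<union> Q')"
proof -
  have winv: "walk w y \<in> Domain Q \<longleftrightarrow> y \<in> Domain Q" if "fst ` set w \<subseteq> I" for w y
    using that by (induction w arbitrary: y) (simp_all add: inv)
  have dj': "y \<in> Domain Q \<Longrightarrow> y \<notin> Domain Q'" for y using dj by blast
  have "walk_closed (Domain (Q \<union> Q'))"
    unfolding walk_closed_def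
  proof (intro ballI allI impI)
    fix y l w assume y: "y \<in> Domain (Q \<union> Q')" and w: "red_word I (l # w)" and e: "walk (l # w) y \<in> Domain (Q \<union> Q')"
    have I: "fst ` set (l # w) \<subseteq> I" "fst l \<in> I" using w by (auto simp: red_word_def)
    show "act l y \<in> Domain (Q \<union> Q')"
    proof (cases "y \<in> Domain Q")
      case True
      then show ?thesis using inv[OF I(2)] by blast
    next
      case False
      then have "y \<in> Domain Q'" "walk (l # w) y \<in> Domain Q'" using y e winv[OF I(1), of y] by blast+
      then have "act l y \<in> Domain Q'" using walk_closedD[of "Domain Q'" y l w] Q' w by (simp add: partial_labeling_def)
      then show ?thesis by blast
    qed
  qed
  moreover have "single_valued (Q \<union> Q')"
    using Q Q' dj' by (auto simp: single_valued_def partial_labeling_def Domain.DomainI)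
  moreover have "step l a b" if "(y, a) \<in> Q \<union> Q'" "fst l \<in> I" "(act l y, b) \<in> Q \<union> Q'" for y a l b
  proof (cases "y \<in> Domain Q")
    case True
    then have "(y, a) \<in> Q" "(act l y, b) \<in> Q" using dj' inv[OF that(2), of y] that by blast+
    then show ?thesis using Q that(2) unfolding partial_labeling_def by blast
  next
    case False
    then have "(y, a) \<in> Q'" "(act l y, b) \<in> Q'" using inv[OF that(2), of y] that by blast+
    then show ?thesis using Q' that(2) unfolding partial_labeling_def by blast
  qed
  ultimately show ?thesis using Q Q' unfolding partial_labeling_def by (auto simp: Range_Un_eq)
qed

lemma partial_labeling_chain:
  assumes "subset.chain {Q. partial_labeling Q} C" "C \<noteq> {}"
  shows "partial_labeling (\<Union>C)"
proof -
  have C: "\<And>Q. Q \<in> C \<Longrightarrow> partial_labeling Q" and two: "\<And>P Q. P \<in> C \<Longrightarrow> Q \<in> C \<Longrightarrow> P \<subseteq> Q \<or> Q \<subseteq> P"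
    using assms(1) by (auto simp: subset_chain_def)
  have common: "\<exists>Q\<in>C. a \<in> Q \<and> b \<in> Q" if "a \<in> \<Union>C" "b \<in> \<Union>C" for a b
  proof -
    obtain P Q where "P \<in> C" "a \<in> P" "Q \<in> C" "b \<in> Q" using \<open>a \<in> \<Union>C\<close> \<open>b \<in> \<Union>C\<close> by blast
    then show ?thesis using two[of P Q] by blast
  qed
  have "walk_closed (Domain (\<Union>C))"
    unfolding walk_closed_def
  proof (intro ballI allI impI)
    fix y l w assume y: "y \<in> Domain (\<Union>C)" and w: "red_word I (l # w)" and e: "walk (l # w) y \<in> Domain (\<Union>C)"
    then obtain a b where "(y, a) \<in> \<Union>C" "(walk (l # w) y, b) \<in> \<Union>C" by blast
    then obtain Q where Q: "Q \<in> C" "y \<in> Domain Q" "walk (l # w) y \<in> Domain Q" using common by blast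
    then have "act l y \<in> Domain Q"
      using walk_closedD[of "Domain Q" y l w] C[OF Q(1)] w by (simp add: partial_labeling_def)
    then show "act l y \<in> Domain (\<Union>C)" using Q(1) by blast
  qed
  moreover have "single_valued (\<Union>C)"
  proof (rule single_valuedI)
    fix y a b assume "(y, a) \<in> \<Union>C" "(y, b) \<in> \<Union>C"
    then obtain Q where "Q \<in> C" "(y, a) \<in> Q" "(y, b) \<in> Q" using common by blast
    then show "a = b" using C unfolding partial_labeling_def by (metis single_valuedD)
  qed
  moreover have "step l a b" if "(y, a) \<in> \<Union>C" "fst l \<in> I" "(act l y, b) \<in> \<Union>C" for y a l b
  proof -
    have "\<exists>Q\<in>C. (y, a) \<in> Q \<and> (act l y, b) \<in> Q" using common[OF that(1,3)] .
    then show ?thesis using C that(2) unfolding partial_labeling_def by blast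
  qed
  moreover have "Range (\<Union>C) \<subseteq> K"
  proof
    fix k assume "k \<in> Range (\<Union>C)"
    then obtain Q where "Q \<in> C" "k \<in> Range Q" by blast
    then show "k \<in> K" using C unfolding partial_labeling_def by blast
  qed
  ultimately show ?thesis unfolding partial_labeling_def by blast
qed

text \<open>The domain of a maximal partial labeling is invariant, since a neighbouring point could
  be added; a missed orbit would contribute a partial labeling of its own.\<close>

theorem exists_labeling:
  obtains c where "\<And>y. c y \<in> K" "\<And>y l. fst l \<in> I \<Longrightarrow> step l (c y) (c (act l y))"
proof -
  have "\<exists>Q\<in>{Q. partial_labeling Q}. \<forall>P\<in>{Q. partial_labeling Q}. Q \<subseteq> P \<longrightarrow> P = Q"
  proof (rule subset_Zorn_nonempty)
    obtain Q where "partial_labeling Q" by (rule partial_labeling_in_orbit)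
    then show "{Q. partial_labeling Q} \<noteq> {}" by blast
  qed (use partial_labeling_chain in blast)
  then obtain Q where Q: "partial_labeling Q" and max: "\<And>P. partial_labeling P \<Longrightarrow> Q \<subseteq> P \<Longrightarrow> P = Q"
    by blast
  have act_Q: "act l y \<in> Domain Q" if y: "y \<in> Domain Q" and l: "fst l \<in> I" for l y
  proof (rule ccontr)
    assume z: "act l y \<notin> Domain Q"
    obtain a where "(y, a) \<in> Q" using y by blast
    then obtain t where "partial_labeling (insert (act l y, t) Q)"
      using partial_labeling_insert[OF Q _ l z] by blast
    then have "insert (act l y, t) Q = Q" using max by blast
    then show False using z by blast
  qed
  have inv: "act l y \<in> Domain Q \<longleftrightarrow> y \<in> Domain Q" if "fst l \<in> I" for l y
    using act_Q[of y l] act_Q[of "act l y" "linv l"] that by auto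
  have winv: "walk w y \<in> Domain Q \<longleftrightarrow> y \<in> Domain Q" if "fst ` set w \<subseteq> I" for w y
    using that by (induction w arbitrary: y) (simp_all add: inv)
  have full: "Domain Q = UNIV"
  proof (rule ccontr)
    assume "Domain Q \<noteq> UNIV"
    then obtain x where x: "x \<notin> Domain Q" by blast
    obtain Q' where Q': "partial_labeling Q'" "Q' \<noteq> {}"
      "\<And>y. y \<in> Domain Q' \<Longrightarrow> \<exists>w. fst ` set w \<subseteq> I \<and> y = walk w x"
      using partial_labeling_in_orbit by blast
    have dj: "Domain Q \<inter> Domain Q' = {}" using Q'(3) winv x by blast
    have "partial_labeling (Q \<union> Q')"
      by (rule partial_labeling_Un[OF Q Q'(1) _ dj]) (rule inv)
    then have "Q' \<subseteq> Q" using max[of "Q \<union> Q'"] by blast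
    then have "Domain Q' = {}" using dj Domain_mono by blast
    then show False using Q'(2) by (simp add: Domain_empty_iff)
  qed
  define c where "c y = (THE a. (y, a) \<in> Q)" for y
  have c: "(y, c y) \<in> Q" for y
  proof -
    obtain a where a: "(y, a) \<in> Q" using full by blast
    moreover have "b = a" if "(y, b) \<in> Q" for b
      using that a Q unfolding partial_labeling_def by (metis single_valuedD)
    ultimately show ?thesis unfolding c_def by (rule theI)
  qed
  show thesis
    by (rule that[of c]) (use c Q in \<open>unfold partial_labeling_def, blast+\<close>)
qed

end

section \<open>Solutions\<close>

lemma Homeo_inv:
  assumes "g \<in> carrier Homeo"
  shows "homeomorphism UNIV UNIV g (inv_into UNIV g)" "inv\<^bsub>Homeo\<^esub> g = inv_into UNIV g"
proof -
  obtain h where h: "homeomorphism UNIV UNIV g h" using assms by (auto simp: Homeo_def)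
  have "inv_into UNIV g = h"
    using h by (intro inv_equality) (auto simp: homeomorphism_def)
  then show gh: "homeomorphism UNIV UNIV g (inv_into UNIV g)" using h by simp
  then have "inv_into UNIV g \<in> carrier Homeo"
    by (auto simp: Homeo_def intro: homeomorphism_symD)
  moreover have "inv_into UNIV g \<circ> g = id" using gh by (auto simp: homeomorphism_def)
  ultimately show "inv\<^bsub>Homeo\<^esub> g = inv_into UNIV g"
    using assms by (intro group.inv_equality[OF group_Homeo]) (simp_all add: Homeo_def)
qed

lemma bij_Homeo: "g \<in> carrier Homeo \<Longrightarrow> bij g"
  using Homeo_inv(1) unfolding homeomorphism_def by (metis bijI' UNIV_I)

section \<open>Witnesses for deduced congruences, and reduction to a nonredundant subsystem\<close>

context
  fixes G :: "('a::topological_space \<Rightarrow> 'a) set"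
  assumes G: "subgroup G Homeo"
begin

lemma subgroup_Homeo_sub: "g \<in> G \<Longrightarrow> g \<in> carrier Homeo"
  using subgroup.subset[OF G] by blast

lemma subgroup_Homeo_id: "id \<in> G"
  using subgroup.one_closed[OF G] by (simp add: Homeo_def)

lemma subgroup_Homeo_comp: "g \<in> G \<Longrightarrow> h \<in> G \<Longrightarrow> g \<circ> h \<in> G"
  using subgroup.m_closed[OF G, of g h] by (simp add: Homeo_def)

lemma subgroup_Homeo_inv: "g \<in> G \<Longrightarrow> inv_into UNIV g \<in> G"
  using subgroup.m_inv_closed[OF G, of g] Homeo_inv(2)[OF subgroup_Homeo_sub] by simp

text \<open>The rules of deduction act on witnesses: symmetry inverts, transitivity composes, and
  complement keeps the same bijection because the pieces partition the space.\<close>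

lemma deducible_witness:
  assumes S: "disjoint_family_on S {1..r}" "(\<Union>k\<in>{1..r}. S k) = UNIV"
    and C: "\<And>A B. (A, B) \<in> C \<Longrightarrow> A \<subseteq> {1..r} \<and> B \<subseteq> {1..r} \<and> (\<exists>\<sigma>\<in>G. witnesses \<sigma> S A B)"
    and "deducible r C A B"
  shows "A \<subseteq> {1..r} \<and> B \<subseteq> {1..r} \<and> (\<exists>\<sigma>\<in>G. witnesses \<sigma> S A B)"
  using assms(4)
proof (induction rule: deducible.induct)
  case (member A B)
  then show ?case using C by blast
next
  case (member_sym A B)
  then obtain \<sigma> where \<sigma>: "\<sigma> \<in> G" "witnesses \<sigma> S A B" using C by blast
  have "inv_into UNIV \<sigma> ` \<sigma> ` (\<Union>k\<in>A. S k) = (\<Union>k\<in>A. S k)"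
    by (rule image_inv_f_f) (use bij_Homeo[OF subgroup_Homeo_sub[OF \<sigma>(1)]] in \<open>simp add: bij_def\<close>)
  then have "witnesses (inv_into UNIV \<sigma>) S B A" using \<sigma>(2) by (simp add: witnesses_def)
  then show ?case using C[OF member_sym] subgroup_Homeo_inv[OF \<sigma>(1)] by blast
next
  case (complement A B)
  then obtain \<sigma> where \<sigma>: "\<sigma> \<in> G" "witnesses \<sigma> S A B" by blast
  have compl: "(\<Union>k\<in>{1..r} - A. S k) = - (\<Union>k\<in>A. S k)" if "A \<subseteq> {1..r}" for A
  proof -
    have "S j \<inter> S k = {}" if "j \<in> A" "k \<in> {1..r} - A" for j k
      using that \<open>A \<subseteq> {1..r}\<close> by (intro disjoint_family_onD[OF S(1)]) auto
    then have dj: "(\<Union>k\<in>{1..r} - A. S k) \<inter> (\<Union>k\<in>A. S k) = {}" by blast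
    have "(\<Union>k\<in>{1..r} - A. S k) \<union> (\<Union>k\<in>A. S k) = (\<Union>k\<in>{1..r}. S k)"
      using that by blast
    then have un: "(\<Union>k\<in>{1..r} - A. S k) \<union> (\<Union>k\<in>A. S k) = UNIV" by (simp only: S(2))
    have "X \<inter> Y = {} \<Longrightarrow> X \<union> Y = UNIV \<Longrightarrow> X = - Y" for X Y :: "'a set" by blast
    from this[OF dj un] show ?thesis .
  qed
  have "\<sigma> ` (- (\<Union>k\<in>A. S k)) = - \<sigma> ` (\<Union>k\<in>A. S k)"
    by (rule bij_image_Compl_eq[OF bij_Homeo[OF subgroup_Homeo_sub[OF \<sigma>(1)]]])
  then have "witnesses \<sigma> S ({1..r} - A) ({1..r} - B)"
    using \<sigma>(2) complement compl by (simp add: witnesses_def)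
  then show ?case using \<sigma>(1) by blast
next
  case (transitive A M B)
  then obtain \<sigma> \<tau> where *: "\<sigma> \<in> G" "witnesses \<sigma> S A M" "\<tau> \<in> G" "witnesses \<tau> S M B" by blast
  then have "witnesses (\<tau> \<circ> \<sigma>) S A B"
    unfolding witnesses_def by (simp only: image_comp[symmetric])
  moreover have "\<tau> \<circ> \<sigma> \<in> G" using * by (intro subgroup_Homeo_comp)
  ultimately show ?case using transitive by blast
qed

end

text \<open>Deducibility is not reflexive: a congruence with equal sides need not follow from other
  congruences, hence the alternative \<open>A = B\<close>.\<close>

lemma deducible_cut:
  assumes "deducible r C A B" "\<And>A B. (A, B) \<in> C \<Longrightarrow> A = B \<or> deducible r C' A B"
  shows "A = B \<or> deducible r C' A B"
  using assms(1)
proof (induction rule: deducible.induct)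
  case (member_sym A B)
  then show ?case using assms(2)[OF member_sym] deducible_sym by blast
qed (use assms(2) in \<open>blast intro: deducible.complement deducible.transitive\<close>)+

lemma deducible_mono: "deducible r C A B \<Longrightarrow> C \<subseteq> C' \<Longrightarrow> deducible r C' A B"
  by (induction rule: deducible.induct) (auto intro: deducible.intros)

lemma sub_deducible_mono: "sub_deducible r C A B \<Longrightarrow> C \<subseteq> C' \<Longrightarrow> sub_deducible r C' A B"
  by (induction rule: sub_deducible.induct) (auto intro: sub_deducible.intros)

text \<open>A subset of least size from which all other nontrivial congruences follow; by
  \<open>deducible_cut\<close>, a member that is trivial or follows from the others could be
  removed.\<close>

lemma exists_nonredundant_subsystem:
  assumes "finite J"
  obtains I where "I \<subseteq> J" "\<And>i. i \<in> I \<Longrightarrow> \<not> deducible r (congs L R (I - {i})) (L i) (R i) \<and> L i \<noteq> R i"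
    "\<And>i. i \<in> J \<Longrightarrow> L i = R i \<or> deducible r (congs L R I) (L i) (R i)"
proof -
  define P where "P I \<longleftrightarrow> I \<subseteq> J \<and> (\<forall>i\<in>J. L i = R i \<or> deducible r (congs L R I) (L i) (R i))" for I
  have "P J" by (auto simp: P_def congs_def intro: deducible.member)
  then obtain I where I: "P I" and min: "\<And>I'. P I' \<Longrightarrow> card I \<le> card I'"
    using ex_has_least_nat[of P J card] by blast
  have finI: "finite I" using I assms by (auto simp: P_def intro: finite_subset)
  have "\<not> (L i = R i \<or> deducible r (congs L R (I - {i})) (L i) (R i))" if i: "i \<in> I" for i
  proof
    assume *: "L i = R i \<or> deducible r (congs L R (I - {i})) (L i) (R i)"
    have "A = B \<or> deducible r (congs L R (I - {i})) A B" if AB: "(A, B) \<in> congs L R I" for A B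
    proof -
      obtain j where j: "j \<in> I" "A = L j" "B = R j" using AB by (auto simp: congs_def)
      show ?thesis
      proof (cases "j = i")
        case False
        then have "(A, B) \<in> congs L R (I - {i})" using j by (auto simp: congs_def)
        then show ?thesis by (blast intro: deducible.member)
      qed (use * j in simp)
    qed
    then have "L j = R j \<or> deducible r (congs L R (I - {i})) (L j) (R j)" if "j \<in> J" for j
      using that I deducible_cut[of r "congs L R I" "L j" "R j" "congs L R (I - {i})"]
      unfolding P_def by blast
    then have "P (I - {i})" using I unfolding P_def by blast
    then show False using min[of "I - {i}"] i finI by (meson card_Diff1_less leD)
  qed
  then show thesis using that[of I] I unfolding P_def by blast
qed

section \<open>From group elements to words, and assembly of the solution\<close>

lemma red_word_rev: "red_word I (rev w) \<longleftrightarrow> red_word I w"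
proof -
  have "(\<lambda>x y. x \<noteq> linv y) = (\<lambda>x y. y \<noteq> linv x)" by (metis linv_linv)
  then show ?thesis by (simp only: red_word_def reduced_word_altdef successively_rev set_rev)
qed

lemma letter_val_Homeo:
  assumes "f (fst l) \<in> carrier Homeo"
  shows "letter_val Homeo f l = (if snd l then f (fst l) else inv_into UNIV (f (fst l)))"
  using Homeo_inv(2)[OF assms] by (simp add: letter_val_def)

lemma word_val_subgroup:
  assumes "group G" "subgroup H G" "f ` I \<subseteq> H" "fst ` set w \<subseteq> I"
  shows "word_val (G\<lparr>carrier := H\<rparr>) f w = word_val G f w"
  using assms(4)
proof (induction w)
  case (Cons l w)
  have "f (fst l) \<in> H" using Cons.prems assms(3) by auto
  then have "letter_val (G\<lparr>carrier := H\<rparr>) f l = letter_val G f l"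
    using group.m_inv_consistent[OF assms(1,2)] by (simp add: letter_val_def)
  then show ?case using Cons by (simp add: word_val_def)
qed (simp add: word_val_def)

text \<open>Two equal powers of \<open>f i\<close> would make a positive power the identity, against
  freeness.\<close>

lemma infinite_of_free_element:
  assumes G: "subgroup G Homeo" and g: "f i \<in> G"
    and free: "\<And>w. red_word {i} w \<Longrightarrow> w \<noteq> [] \<Longrightarrow> word_val Homeo f w \<noteq> id"
  shows "infinite G"
proof
  assume fin: "finite G"
  let ?g = "f i"
  have pow: "word_val Homeo f (replicate n (i, True)) = ?g ^^ n" for n
    by (induction n) (simp_all add: word_val_def letter_val_def Homeo_def funpow_swap1 o_def id_def)
  have "?g ^^ n \<in> G" for n
    by (induction n) (simp_all only: funpow.simps subgroup_Homeo_id[OF G] subgroup_Homeo_comp[OF G] g)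
  then have "finite (range (\<lambda>n. ?g ^^ n))" using fin by (auto intro: finite_subset)
  then have "\<not> inj (\<lambda>n. ?g ^^ n)" using finite_imageD infinite_UNIV_nat by blast
  then obtain a b where "a \<noteq> b" "?g ^^ a = ?g ^^ b" by (auto simp: inj_on_def)
  then obtain a b where ab: "a < b" "?g ^^ a = ?g ^^ b" by (metis linorder_neqE_nat)
  have "inj (?g ^^ a)"
    using bij_Homeo[OF subgroup_Homeo_sub[OF G g]] by (simp add: bij_def inj_fn)
  moreover have "(?g ^^ a) ((?g ^^ (b - a)) x) = (?g ^^ a) x" for x
    using ab funpow_add[of a "b - a" ?g] by (simp add: fun_eq_iff)
  ultimately have "?g ^^ (b - a) = id" by (auto simp: fun_eq_iff dest: injD)
  moreover have "red_word {i} (replicate n (i, True))" for n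
    by (induction n) (auto simp: red_word_Cons linv_def)
  ultimately show False using free[of "replicate (b - a) (i, True)"] pow ab by simp
qed

text \<open>\<open>infinite G\<close> is assumed separately because \<open>I\<close> may be empty,
  and then the condition on words says nothing about \<open>G\<close>.\<close>

lemma exists_baire_solution:
  fixes G :: "('a::polish_space \<Rightarrow> 'a) set" and f :: "nat \<Rightarrow> 'a \<Rightarrow> 'a"
  assumes sys: "nonredundant_congruence_system r I L R" and "finite I"
    and G: "subgroup G Homeo" "acts_freely_on_comeager G" "acts_locally_commutatively G" "infinite G"
    and fG: "\<And>i. i \<in> I \<Longrightarrow> f i \<in> G"
    and free: "\<And>w. red_word I w \<Longrightarrow> w \<noteq> [] \<Longrightarrow> word_val Homeo f w \<noteq> id"
  obtains A where "\<And>k. k \<in> {1..r} \<Longrightarrow> \<not> meager (A k) \<and> baire_property (A k)"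
    "disjoint_family_on A {1..r}" "(\<Union>k\<in>{1..r}. A k) = UNIV"
    "\<And>i. i \<in> I \<Longrightarrow> witnesses (f i) A (L i) (R i)"
proof -
  interpret nonredundant_congruence_system r I L R by (rule sys)
  \<comment> \<open>The identity outside \<open>I\<close>, so that the inverse law and continuity
    hold for every letter.\<close>
  define act where "act l = (if fst l \<in> I then letter_val Homeo f l else id)" for l
  have fH: "f i \<in> carrier Homeo" if "i \<in> I" for i using subgroup_Homeo_sub[OF G(1) fG[OF that]] .
  have act_eq: "act l = (if snd l then f (fst l) else inv_into UNIV (f (fst l)))" if "fst l \<in> I" for l
    using letter_val_Homeo[of f l, OF fH[OF that]] that by (simp add: act_def)
  have actG: "act l \<in> G" for l
    using act_eq[of l] fG subgroup_Homeo_id[OF G(1)] subgroup_Homeo_inv[OF G(1)]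
    by (cases "fst l \<in> I") (auto simp: act_def)
  have act_inv: "act (linv l) (act l y) = y" for l y
  proof (cases "fst l \<in> I")
    case True
    have "homeomorphism UNIV UNIV (f (fst l)) (inv_into UNIV (f (fst l)))"
      using Homeo_inv(1)[OF fH[OF True]] .
    then show ?thesis using act_eq[of l] act_eq[of "linv l"] True
      by (auto simp: linv_def homeomorphism_def)
  qed (simp add: act_def)
  interpret congruence_action r I L R act by unfold_locales (rule act_inv)
  have walkG: "walk w \<in> G" for w
  proof (induction w)
    case (Cons l w)
    have "walk (l # w) = walk w \<circ> act l" by (simp add: fun_eq_iff)
    then show ?case by (simp only: subgroup_Homeo_comp[OF G(1) Cons actG])
  qed (simp only: fold_Nil subgroup_Homeo_id[OF G(1)])
  \<comment> \<open>\<open>word_val\<close> applies its last letter first, whereas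
    \<open>walk\<close> applies its first letter first; hence \<open>rev\<close>.\<close>
  have word_val: "word_val Homeo f (rev w) = walk w" if "fst ` set w \<subseteq> I" for w
    using that
  proof (induction w rule: rev_induct)
    case (snoc l w)
    then have "word_val Homeo f (rev (w @ [l])) = act l \<circ> word_val Homeo f (rev w)"
      by (simp add: word_val_def act_def Homeo_def)
    then show ?case using snoc by simp
  qed (simp add: word_val_def Homeo_def)
  have walk_free: "walk w \<noteq> id" if "red_word I w" "w \<noteq> []" for w
    using free[of "rev w"] that word_val[of w] by (simp add: red_word_rev) (simp add: red_word_def)
  have comm: "g \<circ> h = h \<circ> g" if "g \<in> G" "h \<in> G" "g x = x" "h x = x" for g h x
    using G(3) that unfolding acts_locally_commutatively_def by metis
  interpret commuting_congruence_action r I L R act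
  proof
    show "\<exists>y. walk w y \<noteq> y" if "red_word I w" "w \<noteq> []" for w
      using walk_free[OF that] by (auto simp: fun_eq_iff)
    show "walk u (walk v y) = walk v (walk u y)" if "walk u x = x" "walk v x = x" for u v x y
    proof -
      have "walk u \<circ> walk v = walk v \<circ> walk u"
        by (rule comm[OF walkG walkG that])
      from fun_cong[OF this, of y] show ?thesis by simp
    qed
  qed
  obtain D where cD: "comeager D"
    and D': "\<forall>g\<in>G. g ` D = D" "\<forall>g\<in>G. g \<noteq> id \<longrightarrow> (\<forall>x\<in>D. g x \<noteq> x)"
    using G(2) unfolding acts_freely_on_comeager_def by (elim exE conjE)
  have D: "g ` D = D" "g \<noteq> id \<Longrightarrow> x \<in> D \<Longrightarrow> g x \<noteq> x" if "g \<in> G" for g x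
    using D' that by simp_all
  \<comment> \<open>Freeness on \<open>D\<close>: elements of \<open>G\<close> that agree at one
    point of \<open>D\<close> are equal, so separating translates of points reduces to separating
    elements of \<open>G\<close>.\<close>
  have G_eq: "g = h" if "g \<in> G" "h \<in> G" "x \<in> D" "g x = h x" for g h x
  proof -
    have bij: "bij h" using bij_Homeo subgroup_Homeo_sub[OF G(1) that(2)] by blast
    let ?i = "inv_into UNIV h"
    have hi: "h (?i y) = y" "?i (h y) = y" for y
      using bij by (simp_all add: bij_def surj_f_inv_f)
    have "?i \<circ> g \<in> G" using subgroup_Homeo_comp[OF G(1) subgroup_Homeo_inv[OF G(1)]] that by blast
    moreover have "(?i \<circ> g) x = x" using that(4) hi by simp
    ultimately have "?i \<circ> g = id" using D(2)[of "?i \<circ> g" x] that(3) by blast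
    then have "g y = h y" for y using hi by (metis comp_apply id_apply)
    then show ?thesis by blast
  qed
  interpret baire_congruence_action r I L R act D
  proof unfold_locales
    show "act l y \<in> D" if "y \<in> D" for y l using D(1)[OF actG[of l]] that by blast
    show "walk w y \<noteq> y" if "y \<in> D" "red_word I w" "w \<noteq> []" for y w
      by (rule D(2)[OF walkG walk_free[OF that(2,3)] that(1)])
    show "continuous_on UNIV (act l)" for l
      using Homeo_inv(1)[OF subgroup_Homeo_sub[OF G(1) actG[of l]]] by (simp add: homeomorphism_def)
    show "finite I" "comeager D" by fact+
    fix n
    let ?W = "walk ` {w. red_word I w \<and> length w \<le> n}"
    have finW: "finite ?W" by (intro finite_imageI finite_red_words \<open>finite I\<close>)
    \<comment> \<open>Greedy choice in the infinite group: each \<open>h k\<close> avoids the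
      finitely many maps \<open>u \<circ> h j\<close> with \<open>j < k\<close>. The pairs with
      \<open>j > k\<close> are handled afterwards by inverse words.\<close>
    have "\<exists>h :: nat \<Rightarrow> 'a \<Rightarrow> 'a. \<forall>k. h k \<in> G \<and> (\<forall>j<k. \<forall>u\<in>?W. h k \<noteq> u \<circ> h j)"
    proof (rule dependent_wellorder_choice)
      fix k and h :: "nat \<Rightarrow> 'a \<Rightarrow> 'a"
      define X where "X = (\<lambda>(u, j). u \<circ> h j) ` (?W \<times> {..<k})"
      have "finite X" using finW by (simp add: X_def)
      then have "\<not> G \<subseteq> X" using G(4) finite_subset by blast
      then obtain g where g: "g \<in> G" "g \<notin> X" by blast
      have "u \<circ> h j \<in> X" if "j < k" "u \<in> ?W" for u j
        unfolding X_def by (rule image_eqI[of _ _ "(u, j)"]) (use that in simp_all)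
      then show "\<exists>g. g \<in> G \<and> (\<forall>j<k. \<forall>u\<in>?W. g \<noteq> u \<circ> h j)" using g by blast
    qed auto
    then obtain h :: "nat \<Rightarrow> 'a \<Rightarrow> 'a" where h: "\<And>k. h k \<in> G" "\<And>k j u. j < k \<Longrightarrow> u \<in> ?W \<Longrightarrow> h k \<noteq> u \<circ> h j"
      by metis
    have sep: "j = k" if x: "x \<in> D" and w: "red_word I w" "length w \<le> n" and eq: "walk w (h j x) = h k x" for j k x w
    proof -
      have "walk w \<circ> h j = h k" using G_eq[OF subgroup_Homeo_comp[OF G(1) walkG h(1)] h(1) x] eq by simp
      moreover have "h j = walk (winv w) \<circ> h k" unfolding calculation[symmetric] by (simp add: fun_eq_iff)
      moreover have "walk w \<in> ?W" "walk (winv w) \<in> ?W" using w by (intro imageI; simp)+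
      ultimately show ?thesis using h(2)[of j k] h(2)[of k j] by (metis linorder_neqE_nat)
    qed
    have hom: "\<exists>h'. homeomorphism UNIV UNIV (h k) h'" for k
      using Homeo_inv(1)[OF subgroup_Homeo_sub[OF G(1) h(1)]] by blast
    have hD: "h k ` D \<subseteq> D" for k using D(1)[OF h(1)] by blast
    show "\<exists>h. (\<forall>k\<in>{1..r}. (\<exists>h'. homeomorphism UNIV UNIV (h k) h') \<and> h k ` D \<subseteq> D) \<and>
      (\<forall>j\<in>{1..r}. \<forall>k\<in>{1..r}. \<forall>x\<in>D. \<forall>w. red_word I w \<and> length w \<le> n \<and> walk w (h j x) = h k x \<longrightarrow> j = k)"
    proof (rule exI[of _ h], intro conjI ballI allI impI)
      show "j = k" if "x \<in> D" "red_word I w \<and> length w \<le> n \<and> walk w (h j x) = h k x" for j k x w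
        using sep[of x w j k] that by simp
    qed (rule hom hD)+
  qed
  obtain E c1 where E: "comeager E" "E \<subseteq> D" "\<And>y l. y \<in> E \<Longrightarrow> fst l \<in> I \<Longrightarrow> act l y \<in> E"
    and c1: "\<And>y. y \<in> E \<Longrightarrow> c1 y \<in> {1..r}"
      "\<And>y l. y \<in> E \<Longrightarrow> fst l \<in> I \<Longrightarrow> step l (c1 y) (c1 (act l y))"
      "\<And>k. k \<in> {1..r} \<Longrightarrow> baire_property {y \<in> E. c1 y = k} \<and> \<not> meager {y \<in> E. c1 y = k}"
    by (rule exists_baire_labeling, rule that, assumption+)
  obtain c2 where c2: "\<And>y. c2 y \<in> {1..r}" "\<And>y l. fst l \<in> I \<Longrightarrow> step l (c2 y) (c2 (act l y))"
    by (rule exists_labeling, rule that, assumption+)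
  \<comment> \<open>\<open>E\<close> is invariant, so no condition on labels links the two
    labelings.\<close>
  define c where "c y = (if y \<in> E then c1 y else c2 y)" for y
  define A where "A k = {y. c y = k}" for k
  have E_iff: "act l y \<in> E \<longleftrightarrow> y \<in> E" if "fst l \<in> I" for l y
    using E(3)[of y l] E(3)[of "act l y" "linv l"] that by auto
  have step_c: "step l (c y) (c (act l y))" if "fst l \<in> I" for l y
    using c1(2) c2(2) that E_iff[OF that] by (simp add: c_def)
  have cK: "c y \<in> {1..r}" for y unfolding c_def using c1(1) c2(1) by presburger
  show thesis
  proof (rule that[of A])
    show "disjoint_family_on A {1..r}" by (auto simp: A_def disjoint_family_on_def)
    show "(\<Union>k\<in>{1..r}. A k) = UNIV" using cK by (auto simp: A_def)
    fix k assume k: "k \<in> {1..r}"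
    have eq: "A k = {y. y \<in> {y \<in> E. c1 y = k} \<or> y \<in> A k - E}" by (auto simp: A_def c_def)
    \<comment> \<open>Off \<open>E\<close> the labeling comes from the axiom of choice, but there it
      changes the pieces only by meager sets.\<close>
    have "meager (A k - E)"
      by (rule meager_subset[of "- E"]) (use E(1) in \<open>auto simp: comeager_def\<close>)
    then have "baire_property {y. y \<in> A k - E}" by (simp only: Collect_mem_eq baire_property_meager)
    moreover have "baire_property {y. y \<in> {y \<in> E. c1 y = k}}" using c1(3)[OF k] by simp
    ultimately have "baire_property (A k)" by (subst eq) (rule baire_property_Collect_disj)
    moreover have "{y \<in> E. c1 y = k} \<subseteq> A k" by (auto simp: A_def c_def)
    ultimately show "\<not> meager (A k) \<and> baire_property (A k)" using c1(3)[OF k] meager_subset[of "A k"] by blast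
  next
    fix i assume i: "i \<in> I"
    have iff: "c y \<in> L i \<longleftrightarrow> c (f i y) \<in> R i" for y
      using step_c[of "(i, True)" y] act_eq[of "(i, True)"] i by (simp add: step_def src_def tgt_def)
    have "surj (f i)" using bij_Homeo[OF fH[OF i]] by (simp add: bij_def)
    then have "f i ` {y. c y \<in> L i} = {y. c y \<in> R i}" using iff by (auto simp: image_iff)
    moreover have "(\<Union>k\<in>P. A k) = {y. c y \<in> P}" for P by (auto simp: A_def)
    ultimately show "witnesses (f i) A (L i) (R i)" by (simp add: witnesses_def)
  qed
qed

theorem theorem2p4:
  fixes G :: "('a::polish_space \<Rightarrow> 'a) set"
    and r m :: nat
    and L R :: "nat \<Rightarrow> nat set"
  assumes "r \<ge> 1" and "m \<ge> 1"
    and "subgroup G Homeo"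
    and "countable G"
    and "acts_freely_on_comeager G"
    and "acts_locally_commutatively G"
    and "\<exists>H. subgroup H (Homeo\<lparr>carrier := G\<rparr>) \<and> free_on (Homeo\<lparr>carrier := H\<rparr>) m"
    and "\<forall>i\<in>{1..m}. L i \<subseteq> {1..r} \<and> R i \<subseteq> {1..r}"
    and "weak_system r m L R"
    and "consistent_system r m L R"
  shows "(\<exists>A :: nat \<Rightarrow> 'a set.
            (\<forall>k\<in>{1..r}. \<not> meager (A k) \<and> baire_property (A k)) \<and>
            is_solution G r m L R A) \<and>
         (\<forall>f :: nat \<Rightarrow> 'a \<Rightarrow> 'a.
            nonredundant_system r m L R \<and>
            (\<forall>i\<in>{1..m}. f i \<in> G) \<and>
            (\<exists>H. subgroup H (Homeo\<lparr>carrier := G\<rparr>) \<and>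
                 free_generators (Homeo\<lparr>carrier := H\<rparr>) {1..m} f) \<longrightarrow>
            (\<exists>A :: nat \<Rightarrow> 'a set.
               (\<forall>k\<in>{1..r}. \<not> meager (A k) \<and> baire_property (A k)) \<and>
               is_solution G r m L R A \<and>
               (\<forall>i\<in>{1..m}. witnesses (f i) A (L i) (R i))))"
proof -
  note G = \<open>subgroup G Homeo\<close>
  let ?J = "{1..m}"
  have free: "f i \<in> G" "word_val Homeo f w \<noteq> id"
    if H: "subgroup H (Homeo\<lparr>carrier := G\<rparr>)" "free_generators (Homeo\<lparr>carrier := H\<rparr>) ?J f"
      and "i \<in> ?J" "red_word ?J w" "w \<noteq> []" for H f i w
  proof -
    have "subgroup H Homeo" by (rule group.incl_subgroup[OF group_Homeo G H(1)])
    moreover have fH: "f ` ?J \<subseteq> H" using H(2) by (simp add: free_generators_def)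
    ultimately have "word_val (Homeo\<lparr>carrier := H\<rparr>) f w = word_val Homeo f w"
      using that(4) by (intro word_val_subgroup[OF group_Homeo]) (auto simp: red_word_def)
    moreover have "word_val (Homeo\<lparr>carrier := H\<rparr>) f w \<noteq> \<one>\<^bsub>Homeo\<^esub>"
      using H(2) that(4,5) by (simp add: free_generators_def red_word_def)
    ultimately show "word_val Homeo f w \<noteq> id" by (simp add: Homeo_def)
    have "f i \<in> H" using fH that(3) by blast
    then show "f i \<in> G" using subgroup.subset[OF H(1)] by auto
  qed
  have sys: "nonredundant_congruence_system r I L R"
    if "I \<subseteq> ?J" "\<And>i. i \<in> I \<Longrightarrow> \<not> deducible r (congs L R (I - {i})) (L i) (R i) \<and> L i \<noteq> R i" for I
  proof unfold_locales
    have sub: "congs L R I \<subseteq> congs L R ?J" using that(1) by (auto simp: congs_def)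
    show "\<not> deducible r (congs L R I) A ({1..r} - A)" if "A \<subseteq> {1..r}" for A
      using \<open>weak_system r m L R\<close> deducible_mono[OF _ sub] that unfolding weak_system_def by blast
    show "\<not> sub_deducible r (congs L R I) A B" if "A \<subseteq> {1..r}" "B \<subset> A" for A B
      using \<open>consistent_system r m L R\<close> sub_deducible_mono[OF _ sub] that
      unfolding consistent_system_def by blast
  qed (use assms(1,8) that in auto)
  obtain H g where Hg: "subgroup H (Homeo\<lparr>carrier := G\<rparr>)" "free_generators (Homeo\<lparr>carrier := H\<rparr>) ?J g"
    using assms(7) by (auto simp: free_on_def)
  have red_word1: "red_word ?J [(1, True)]" using \<open>m \<ge> 1\<close> by (simp add: red_word_Cons)
  have inf: "infinite G"
  proof (rule infinite_of_free_element[OF G, of g 1])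
    show "g 1 \<in> G" using free(1)[OF Hg _ red_word1] \<open>m \<ge> 1\<close> by simp
    have "{1} \<subseteq> ?J" using \<open>m \<ge> 1\<close> by simp
    then have "red_word ?J w" if "red_word {1} w" for w using that unfolding red_word_def by blast
    then show "word_val Homeo g w \<noteq> id" if "red_word {1} w" "w \<noteq> []" for w
      using free(2)[OF Hg, of 1 w] that \<open>m \<ge> 1\<close> by simp
  qed
  note solution = exists_baire_solution[OF sys _ G assms(5,6) inf]
  show ?thesis
  proof (intro conjI allI impI; (elim conjE exE)?)
    obtain I where I: "I \<subseteq> ?J" "\<And>i. i \<in> I \<Longrightarrow> \<not> deducible r (congs L R (I - {i})) (L i) (R i) \<and> L i \<noteq> R i"
      "\<And>i. i \<in> ?J \<Longrightarrow> L i = R i \<or> deducible r (congs L R I) (L i) (R i)"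
      using exists_nonredundant_subsystem[of ?J r L R] by (metis finite_atLeastAtMost)
    obtain A where A: "\<And>k. k \<in> {1..r} \<Longrightarrow> \<not> meager (A k) \<and> baire_property (A k)"
      "disjoint_family_on A {1..r}" "(\<Union>k\<in>{1..r}. A k) = UNIV"
      "\<And>i. i \<in> I \<Longrightarrow> witnesses (g i) A (L i) (R i)"
    proof (rule solution[of I g])
      show "finite I" using I(1) by (rule finite_subset) simp
      show "g i \<in> G" if "i \<in> I" for i using free(1)[OF Hg _ red_word1] that I(1) by auto
      show "word_val Homeo g w \<noteq> id" if "red_word I w" "w \<noteq> []" for w
        using free(2)[OF Hg, of 1 w] that I(1) \<open>m \<ge> 1\<close> by (auto simp: red_word_def)
      show "I \<subseteq> ?J" by (rule I(1))
      show "\<not> deducible r (congs L R (I - {i})) (L i) (R i) \<and> L i \<noteq> R i" if "i \<in> I" for i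
        by (rule I(2)[OF that])
    qed blast
    have C: "P \<subseteq> {1..r} \<and> Q \<subseteq> {1..r} \<and> (\<exists>\<sigma>\<in>G. witnesses \<sigma> A P Q)" if PQ: "(P, Q) \<in> congs L R I" for P Q
    proof -
      obtain i where i: "i \<in> I" "P = L i" "Q = R i" using PQ by (auto simp: congs_def)
      then have "g i \<in> G" using free(1)[OF Hg _ red_word1] I(1) by auto
      then show ?thesis using A(4)[OF i(1)] i I(1) assms(8) by blast
    qed
    \<comment> \<open>Beyond the subsystem, congruences with equal sides are witnessed by the
      identity and the others through their deduction.\<close>
    have "\<exists>\<sigma>\<in>G. witnesses \<sigma> A (L i) (R i)" if "i \<in> ?J" for i
      using I(3)[OF that]
    proof
      assume "L i = R i"
      then have "witnesses id A (L i) (R i)" by (simp add: witnesses_def)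
      then show ?thesis using subgroup_Homeo_id[OF G] by blast
    next
      assume "deducible r (congs L R I) (L i) (R i)"
      then show ?thesis using deducible_witness[OF G A(2,3) C] by blast
    qed
    then show "\<exists>A. (\<forall>k\<in>{1..r}. \<not> meager (A k) \<and> baire_property (A k)) \<and> is_solution G r m L R A"
      using A unfolding is_solution_def by blast
  next
    fix f H
    assume nr: "nonredundant_system r m L R" and fG: "\<forall>i\<in>?J. f i \<in> G"
      and Hf: "subgroup H (Homeo\<lparr>carrier := G\<rparr>)" "free_generators (Homeo\<lparr>carrier := H\<rparr>) ?J f"
    obtain A where A: "\<And>k. k \<in> {1..r} \<Longrightarrow> \<not> meager (A k) \<and> baire_property (A k)"
      "disjoint_family_on A {1..r}" "(\<Union>k\<in>{1..r}. A k) = UNIV"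
      "\<And>i. i \<in> ?J \<Longrightarrow> witnesses (f i) A (L i) (R i)"
    proof (rule solution[of ?J f])
      show "word_val Homeo f w \<noteq> id" if "red_word ?J w" "w \<noteq> []" for w
        using free(2)[OF Hf, of 1 w] that \<open>m \<ge> 1\<close> by auto
      show "\<not> deducible r (congs L R (?J - {i})) (L i) (R i) \<and> L i \<noteq> R i" if "i \<in> ?J" for i
        using nr that by (simp add: nonredundant_system_def)
      show "f i \<in> G" if "i \<in> ?J" for i using fG that by blast
    qed auto
    then have "is_solution G r m L R A" using fG unfolding is_solution_def by blast
    then show "\<exists>A. (\<forall>k\<in>{1..r}. \<not> meager (A k) \<and> baire_property (A k)) \<and> is_solution G r m L R A \<and>
      (\<forall>i\<in>?J. witnesses (f i) A (L i) (R i))"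
      using A(1,4) by blast
  qed
qed

end
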